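(* Consider the following algorithm, given a positive integer $x$: (i) By a sieve, build an array storing for each $n \le x$ a prime factor of $n$ (its largest prime factor found by sieving with all primes up to $\sqrt{x}$ in increasing order, writing $p$ at every multiple of $p$), from which factorizations of integers $\le x$ can be recovered by repeated division and lookup. (ii) Initialize a second array $V$ indexed by $n \le x$ with $V[n] = 2$ for odd $n$ and $V[n]=0$ for even $n$. (iii) For each prime $p \le x$: obtain the factorization of $p-1$, and for each odd prime $r \mid p-1$ set $V[n] = 0$ for every $n \le x$ with $n \equiv p \pmod{pr}$. (iv) For each prime $p \le x$ with $p \equiv 3 \pmod 4$, and each multiple $n \le x$ of $p$ with $V[n] = 2$, set $V[n] = 1$. (v) Output the number of $n \le x$ with $V[n] = 1$. Then this algorithm stores at most $O(x)$ integers of size at most $x$ and runs using $O(x (\log x)(\log\log x))$ bit operations.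
   Context: Complexity is measured in bit operations: adding two $k$-bit integers costs $O(k)$ bit operations. $\log$ is the natural logarithm. *)

theory Defs
  imports Complex_Main "HOL-Library.Landau_Symbols"
begin

text \<open>
  Cost model (bit operations).  Integers are natural numbers; the bit length of n is
  bitlen n.  Primitive costs: addition, subtraction, comparison of a and b cost
  max (bitlen a) (bitlen b) (linear in the bit size); multiplication and division with
  remainder cost bitlen a * bitlen b (schoolbook).  An array access A[i] (read or write of
  value v) costs bitlen i + bitlen v (address plus value).  Loop control (increment and
  bound test) is charged explicitly.

  Memory model: the state holds two arrays sF and sV and a list sfl (the factorization of
  p - 1 currently being processed).  pcells records the maximum, over the whole run, of the
  number of stored integers in these, pval the maximal value ever stored in them.
\<close>

fun bitlen :: "nat \<Rightarrow> nat" where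
  "bitlen n = (if n < 2 then 1 else Suc (bitlen (n div 2)))"

definition c_add :: "nat \<Rightarrow> nat \<Rightarrow> nat" where "c_add a b = max (bitlen a) (bitlen b)"
definition c_cmp :: "nat \<Rightarrow> nat \<Rightarrow> nat" where "c_cmp a b = max (bitlen a) (bitlen b)"
definition c_mul :: "nat \<Rightarrow> nat \<Rightarrow> nat" where "c_mul a b = bitlen a * bitlen b"
definition c_divmod :: "nat \<Rightarrow> nat \<Rightarrow> nat" where "c_divmod a b = bitlen a * bitlen b"

record st =
  sF :: "nat list"
  sV :: "nat list"
  sfl :: "nat list"
  cnt :: nat
  cost :: nat
  pcells :: nat
  pval :: nat

definition tick :: "nat \<Rightarrow> st \<Rightarrow> st" where
  "tick c s = s\<lparr>cost := cost s + c\<rparr>"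

definition note_cells :: "st \<Rightarrow> st" where
  "note_cells s = s\<lparr>pcells := max (pcells s) (length (sF s) + length (sV s) + length (sfl s))\<rparr>"

definition rdc :: "nat list \<Rightarrow> nat \<Rightarrow> nat" where
  "rdc A i = bitlen i + bitlen (A ! i)"

definition wrF :: "nat \<Rightarrow> nat \<Rightarrow> st \<Rightarrow> st" where
  "wrF i v s = tick (bitlen i + bitlen v) (s\<lparr>sF := (sF s)[i := v], pval := max (pval s) v\<rparr>)"

definition wrV :: "nat \<Rightarrow> nat \<Rightarrow> st \<Rightarrow> st" where
  "wrV i v s = tick (bitlen i + bitlen v) (s\<lparr>sV := (sV s)[i := v], pval := max (pval s) v\<rparr>)"

definition push_fl :: "nat \<Rightarrow> st \<Rightarrow> st" where
  "push_fl q s = note_cells (tick (bitlen (length (sfl s)) + bitlen q)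
                   (s\<lparr>sfl := sfl s @ [q], pval := max (pval s) q\<rparr>))"

definition init :: "nat \<Rightarrow> st" where
  "init x = fold (\<lambda>i s. wrV i 0 (wrF i 0 s)) [0..<x+1]
     (note_cells \<lparr>sF = replicate (x+1) 0, sV = replicate (x+1) 0, sfl = [], cnt = 0,
                  cost = 0, pcells = 0, pval = 0\<rparr>)"

text \<open>Step (i): sieve; write p at every multiple of p (including p), for every p with
  p*p \<le> x that is still unmarked (i.e. prime), in increasing order.\<close>
definition sieve_mark :: "nat \<Rightarrow> nat \<Rightarrow> st \<Rightarrow> st" where
  "sieve_mark x p s = tick (c_cmp ((x div p + 1) * p) x)
     (fold (\<lambda>k s. tick (c_add (k*p) p) (wrF (k*p) p (tick (c_cmp (k*p) x) s)))
        [1..<x div p + 1] s)"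

definition sieve_step :: "nat \<Rightarrow> nat \<Rightarrow> st \<Rightarrow> st" where
  "sieve_step x p s =
     (let s1 = tick (c_mul p p + c_cmp (p*p) x + rdc (sF s) p + c_cmp (sF s ! p) 0) s;
          s2 = (if sF s ! p = 0 then sieve_mark x p s1 else s1)
      in tick (c_add p 1) s2)"

definition sieve :: "nat \<Rightarrow> st \<Rightarrow> st" where
  "sieve x s =
     (let ps = takeWhile (\<lambda>p. p*p \<le> x) [2..<x+1]; pe = length ps + 2
      in tick (c_mul pe pe + c_cmp (pe*pe) x) (fold (sieve_step x) ps s))"

definition step2 :: "nat \<Rightarrow> st \<Rightarrow> st" where
  "step2 x s = fold (\<lambda>n s. wrV n (if odd n then 2 else 0)
                        (tick (c_cmp n x + c_add n 1 + c_divmod n 2) s)) [0..<x+1] s"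

text \<open>Primality test of p (2 \<le> p \<le> x) via the sieve array: p is prime iff its entry is 0
  (prime above sqrt x) or p itself.\<close>
definition ptest_cost :: "st \<Rightarrow> nat \<Rightarrow> nat" where
  "ptest_cost s p = rdc (sF s) p + c_cmp (sF s ! p) 0 + c_cmp (sF s ! p) p"

definition is_primeF :: "st \<Rightarrow> nat \<Rightarrow> bool" where
  "is_primeF s p \<longleftrightarrow> sF s ! p = 0 \<or> sF s ! p = p"

text \<open>Factorization of m by repeated lookup and division; the distinct prime factors are
  collected in sfl (they appear in non-increasing order, duplicates are skipped).\<close>
function fact_loop :: "nat \<Rightarrow> st \<Rightarrow> st" where
  "fact_loop m s =
    (if m \<le> 1 then tick (c_cmp m 1) s else
      (let f = sF s ! m; q = (if f = 0 then m else f);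
           s1 = tick (c_cmp m 1 + rdc (sF s) m + c_cmp f 0) s;
           s2 = (if sfl s \<noteq> [] \<and> last (sfl s) = q then tick (c_cmp (last (sfl s)) q) s1
                 else push_fl q (tick (if sfl s = [] then 1 else c_cmp (last (sfl s)) q) s1))
       in if q < 2 then s2 else fact_loop (m div q) (tick (c_divmod m q) s2)))"
  by pat_completeness auto
termination by (relation "measure fst") auto

definition mark_V :: "nat \<Rightarrow> nat \<Rightarrow> nat \<Rightarrow> st \<Rightarrow> st" where
  "mark_V x p r s =
     (let pr = p * r; K = (x - p) div pr + 1
      in tick (c_cmp (p + K * pr) x)
          (fold (\<lambda>k s. tick (c_add (p + k*pr) pr) (wrV (p + k*pr) 0 (tick (c_cmp (p + k*pr) x) s)))
             [0..<K] (tick (c_mul p r) s)))"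

definition proc_r :: "nat \<Rightarrow> nat \<Rightarrow> nat \<Rightarrow> st \<Rightarrow> st" where
  "proc_r x p r s = (let s1 = tick (bitlen r + c_divmod r 2) s
                     in if odd r then mark_V x p r s1 else s1)"

definition step3 :: "nat \<Rightarrow> nat \<Rightarrow> st \<Rightarrow> st" where
  "step3 x p s =
     (let s0 = tick (c_cmp p x + c_add p 1 + ptest_cost s p) s
      in if is_primeF s p then
           (let s1 = fact_loop (p - 1) (tick (c_add p 1) (s0\<lparr>sfl := []\<rparr>));
                s2 = fold (proc_r x p) (sfl s1) s1
            in s2\<lparr>sfl := []\<rparr>)
         else s0)"

definition step4 :: "nat \<Rightarrow> nat \<Rightarrow> st \<Rightarrow> st" where
  "step4 x p s =
     (let s0 = tick (c_cmp p x + c_add p 1 + ptest_cost s p) s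
      in if is_primeF s p then
           (let s1 = tick (c_divmod p 4 + c_cmp (p mod 4) 3) s0
            in if p mod 4 = 3 then
                 tick (c_cmp ((x div p + 1) * p) x)
                  (fold (\<lambda>k s. let n = k * p;
                                   s' = tick (c_cmp n x + rdc (sV s) n + c_cmp (sV s ! n) 2) s;
                                   s'' = (if sV s ! n = 2 then wrV n 1 s' else s')
                               in tick (c_add n p) s'')
                     [1..<x div p + 1] s1)
               else s1)
         else s0)"

definition step5 :: "nat \<Rightarrow> st \<Rightarrow> st" where
  "step5 x s = fold (\<lambda>n s. let s' = tick (c_cmp n x + c_add n 1 + rdc (sV s) n + c_cmp (sV s ! n) 1) s
                           in if sV s ! n = 1 then tick (c_add (cnt s) 1) (s'\<lparr>cnt := cnt s + 1\<rparr>) else s')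
                [0..<x+1] s"

definition run :: "nat \<Rightarrow> st" where
  "run x = step5 x (fold (step4 x) [2..<x+1] (fold (step3 x) [2..<x+1] (step2 x (sieve x (init x)))))"

end

theory Submission
  imports Defs "HOL-Number_Theory.Cong" "HOL-Analysis.Analysis" "HOL-Real_Asymp.Real_Asymp"
begin

text \<open>
  All integers handled have \<open>O(log x)\<close> bits, so the cost is governed by the three sums
  \<open>\<Sum> 1/p\<close>, \<open>\<Sum> log p\<close> and \<open>\<Sum> 1/(p r)\<close> over primes \<open>p \<le> x\<close> and, in the last one, over primes
  \<open>r dvd p - 1\<close>; they must be \<open>O(log log x)\<close>, \<open>O(x)\<close> and \<open>O(log log x)\<close>.  The last sum would normally
  be treated with the Brun-Titchmarsh inequality.  A Chebyshev-type argument replaces it: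
  if \<open>D\<close> is the part of \<open>n!\<close> coprime to the prime \<open>r\<close>, then \<open>D\<close> divides the product of \<open>r j + 1\<close> over
  \<open>1 \<le> j \<le> n\<close> and is coprime to every prime \<open>p = r j + 1 > n\<close>.  Hence the product of these
  primes is at most \<open>r^(3 n)\<close>, and at most \<open>O(2^k log r / (k r))\<close> primes \<open>p\<close> in
  \<open>[2^k, 2^(k+1))\<close> satisfy \<open>r dvd p - 1\<close>.  As \<open>\<Sum> log r / r^2\<close> converges, each dyadic block contributes
  \<open>O(1/k)\<close>, and the harmonic sum over \<open>k \<le> log x\<close> gives \<open>log log x\<close>.  The case \<open>r = 2\<close> yields
  the other two sums.

  Factoring \<open>p - 1\<close> costs \<open>O((log p)^2)\<close>: dividing \<open>m\<close> by \<open>q\<close> costs the product of their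
  bit lengths, and the bit length of \<open>q\<close> is at most twice the drop in the bit length of \<open>m\<close>.
\<close>

subsection \<open>Bit lengths\<close>

declare bitlen.simps [simp del] fact_loop.simps [simp del]

lemma bitlen_pos: "1 \<le> bitlen n"
  by (subst bitlen.simps) auto

lemma less_two_power_bitlen: "n < 2 ^ bitlen n"
proof (induction n rule: less_induct)
  case (less n)
  show ?case
  proof (cases "n < 2")
    case True
    then show ?thesis by (simp add: bitlen.simps)
  next
    case False
    then have "n div 2 < 2 ^ bitlen (n div 2)" by (intro less) auto
    then show ?thesis using False by (subst bitlen.simps) auto
  qed
qed

lemma two_power_le_of_bitlen: "0 < n \<Longrightarrow> 2 ^ (bitlen n - 1) \<le> n"
proof (induction n rule: less_induct)
  case (less n)
  show ?case
  proof (cases "n < 2")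
    case True
    then show ?thesis using less.prems by (simp add: bitlen.simps)
  next
    case False
    then have "2 ^ (bitlen (n div 2) - 1) \<le> n div 2" by (intro less) auto
    moreover obtain b where "bitlen (n div 2) = Suc b"
      using bitlen_pos[of "n div 2"] by (cases "bitlen (n div 2)") auto
    ultimately show ?thesis using False by (subst bitlen.simps) auto
  qed
qed

lemma bitlen_le_of_less: "n < 2 ^ k \<Longrightarrow> 1 \<le> k \<Longrightarrow> bitlen n \<le> k"
proof (rule ccontr)
  assume a: "n < 2 ^ k" "1 \<le> k" "\<not> bitlen n \<le> k"
  then have "n > 0" by (auto simp: bitlen.simps split: if_splits intro: gr0I)
  have "(2::nat) ^ k \<le> 2 ^ (bitlen n - 1)" using a by (intro power_increasing) auto
  also have "\<dots> \<le> n" using \<open>n > 0\<close> by (rule two_power_le_of_bitlen)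
  finally show False using a by simp
qed

lemma bitlen_mono: "a \<le> b \<Longrightarrow> bitlen a \<le> bitlen b"
  using less_two_power_bitlen[of b] bitlen_pos[of b] by (intro bitlen_le_of_less) auto

lemma bitlen_add: "bitlen (a + b) \<le> max (bitlen a) (bitlen b) + 1"
proof (rule bitlen_le_of_less)
  have "a < 2 ^ max (bitlen a) (bitlen b)" "b < 2 ^ max (bitlen a) (bitlen b)"
    by (rule less_le_trans[OF less_two_power_bitlen], simp)+
  then show "a + b < 2 ^ (max (bitlen a) (bitlen b) + 1)" by simp
qed simp

lemma bitlen_mult: "bitlen (a * b) \<le> bitlen a + bitlen b"
proof (rule bitlen_le_of_less)
  show "a * b < 2 ^ (bitlen a + bitlen b)"
    unfolding power_add by (intro mult_strict_mono less_two_power_bitlen) auto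
qed (use bitlen_pos[of a] in simp)

lemma bitlen_le: "bitlen n \<le> n + 1"
  by (rule bitlen_le_of_less) (use less_exp[of "n+1"] in auto)

lemma bitlen_le_self: "0 < n \<Longrightarrow> bitlen n \<le> n"
  by (rule bitlen_le_of_less) (use less_exp[of n] in auto)

lemma bitlen_eqI: "2 ^ k \<le> n \<Longrightarrow> n < 2 ^ Suc k \<Longrightarrow> bitlen n = Suc k"
proof (rule antisym)
  assume a: "2 ^ k \<le> n" "n < 2 ^ Suc k"
  then show "bitlen n \<le> Suc k" by (intro bitlen_le_of_less) auto
  have "(2::nat) ^ k < 2 ^ bitlen n" using a less_two_power_bitlen[of n] by linarith
  then show "Suc k \<le> bitlen n" by simp
qed

lemma bitlen_two_le: "2 \<le> n \<Longrightarrow> 2 \<le> bitlen n"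
  using bitlen_mono[of 2 n] by (simp add: bitlen.simps)

text \<open>Multiplying the lower bounds \<open>2 ^ (bitlen n - 1)\<close> of both factors shows
  that the bit lengths of \<open>q\<close> and \<open>m div q\<close> add up to at most
  \<open>bitlen m + 1\<close>; then \<open>2 \<le> bitlen q\<close> gives the claim. It charges a
  division by \<open>q\<close> to the drop in the bit length of \<open>m\<close>.\<close>

lemma bitlen_div:
  assumes "2 \<le> q" "q \<le> m"
  shows "bitlen q + 2 * bitlen (m div q) \<le> 2 * bitlen m"
proof -
  have "0 < m div q" using assms by (simp add: div_greater_zero_iff)
  then have "2 ^ (bitlen (m div q) - 1) \<le> m div q" "2 ^ (bitlen q - 1) \<le> q"
    using assms two_power_le_of_bitlen[of "m div q"] two_power_le_of_bitlen[of q] by auto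
  then have "2 ^ (bitlen (m div q) - 1) * 2 ^ (bitlen q - 1) \<le> m div q * q"
    by (rule mult_mono) auto
  also have "\<dots> \<le> m" by simp
  also have "m < 2 ^ bitlen m" by (rule less_two_power_bitlen)
  finally have "(2::nat) ^ (bitlen (m div q) - 1 + (bitlen q - 1)) < 2 ^ bitlen m"
    by (simp add: power_add)
  then have "bitlen (m div q) - 1 + (bitlen q - 1) < bitlen m" by simp
  then show ?thesis using bitlen_two_le[OF assms(1)] bitlen_pos[of "m div q"] by linarith
qed

subsection \<open>Primes in the progression 1 modulo r\<close>

text \<open>The sum is the exponent of \<open>r\<close> in \<open>n!\<close>. Only the multiples
  \<open>r * i\<close> contribute, each one more than \<open>i\<close> does, so the induction
  hypothesis for \<open>n div r\<close> gives at most \<open>2 * (n div r)\<close>, which is at most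
  \<open>n\<close> since \<open>2 \<le> r\<close>.\<close>

lemma sum_multiplicity_le:
  fixes r n :: nat
  assumes "prime r"
  shows "(\<Sum>j\<in>{1..n}. multiplicity r j) \<le> n"
proof (induction n rule: less_induct)
  case (less n)
  show ?case
  proof (cases "n = 0")
    case False
    let ?m = "n div r"
    have r: "2 \<le> r" using assms by (rule prime_ge_2_nat)
    have *: "{j\<in>{1..n}. r dvd j} = (\<lambda>i. r * i) ` {1..?m}"
    proof safe
      fix j assume "r dvd j" "j \<in> {1..n}"
      then show "j \<in> (\<lambda>i. r * i) ` {1..?m}"
        using r by (intro image_eqI[of _ _ "j div r"]) (auto simp: div_le_mono div_greater_zero_iff dvd_imp_le Suc_le_eq)
    next
      fix i assume "i \<in> {1..?m}"
      then show "r * i \<in> {1..n}" using r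
        by (auto simp: mult.commute less_eq_div_iff_mult_less_eq)
    qed auto
    have "(\<Sum>j\<in>{1..n}. multiplicity r j) = (\<Sum>j\<in>{j\<in>{1..n}. r dvd j}. multiplicity r j)"
      by (rule sum.mono_neutral_right) (auto simp: not_dvd_imp_multiplicity_0)
    also have "\<dots> = (\<Sum>i\<in>{1..?m}. multiplicity r (r * i))"
      unfolding * using r by (subst sum.reindex) (auto simp: inj_on_def)
    also have "\<dots> = (\<Sum>i\<in>{1..?m}. Suc (multiplicity r i))"
      using assms r by (intro sum.cong refl multiplicity_times_same) auto
    also have "\<dots> = ?m + (\<Sum>i\<in>{1..?m}. multiplicity r i)"
      by (simp add: sum_Suc)
    also have "\<dots> \<le> ?m + ?m"
      using less[of ?m] False r by simp
    also have "\<dots> \<le> ?m * r" using mult_le_mono2[OF r, of ?m] by linarith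
    also have "\<dots> \<le> n" by simp
    finally show ?thesis .
  qed simp
qed

lemma fact_split_prime:
  fixes r n :: nat
  assumes "prime r"
  obtains v D where "fact n = r ^ v * D" "coprime D r" "v \<le> n"
proof -
  define v where "v = multiplicity r (fact n :: nat)"
  have "v = (\<Sum>j\<in>{1..n}. multiplicity r j)"
    unfolding v_def fact_prod of_nat_id using assms
    by (subst prime_elem_multiplicity_prod_distrib) auto
  then have v: "v \<le> n" using sum_multiplicity_le[OF assms] by simp
  obtain D where D: "fact n = r ^ v * D"
    unfolding v_def using multiplicity_dvd by (metis dvdE)
  moreover have "coprime D r"
  proof -
    have "\<not> r dvd D"
    proof
      assume "r dvd D"
      then have "r ^ Suc v dvd fact n" unfolding D by (simp add: mult.commute)
      then show False unfolding v_def using assms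
        by (subst (asm) power_dvd_iff_le_multiplicity) (auto simp: not_prime_unit)
    qed
    then show ?thesis using assms prime_imp_coprime coprime_commute by blast
  qed
  ultimately show ?thesis using v that by blast
qed

text \<open>The product is \<open>(n + s)! / s!\<close>, that is, \<open>n!\<close> times a binomial
  coefficient.\<close>

lemma fact_dvd_prod_shift: "fact n dvd (\<Prod>j\<in>{1..n}. j + s :: nat)"
proof -
  have "(\<Prod>j\<in>{1..n}. j + s) * fact s = fact (n + s)"
    by (induction n) (auto simp: algebra_simps)
  moreover have "fact n * fact s dvd (fact (n + s) :: nat)"
    by (rule fact_fact_dvd_fact)
  ultimately show ?thesis
    by (metis dvd_times_right_cancel_iff fact_nonzero)
qed

text \<open>Inverting \<open>r\<close> modulo \<open>D\<close> turns the product over the progression into a binomial product.\<close>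
lemma coprime_dvd_fact_imp_dvd_prod:
  fixes D r n :: nat
  assumes "D dvd fact n" "coprime D r"
  shows "D dvd (\<Prod>j\<in>{1..n}. r * j + 1)"
proof -
  obtain s where s: "[r * s = 1] (mod D)"
    using cong_solve_coprime_nat[of r D] assms(2) by (auto simp: coprime_commute)
  have "[(\<Prod>j\<in>{1..n}. r * j + 1) = (\<Prod>j\<in>{1..n}. r * j + r * s)] (mod D)"
    using s by (intro cong_prod cong_add cong_refl) (auto simp: cong_sym)
  also have "(\<Prod>j\<in>{1..n}. r * j + r * s) = r ^ n * (\<Prod>j\<in>{1..n}. j + s)"
    by (simp add: prod.distrib flip: distrib_left)
  finally have c: "[(\<Prod>j\<in>{1..n}. r * j + 1) = r ^ n * (\<Prod>j\<in>{1..n}. j + s)] (mod D)" .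
  have "D dvd r ^ n * (\<Prod>j\<in>{1..n}. j + s)"
    using assms(1) fact_dvd_prod_shift[of n s] by (meson dvd_mult dvd_trans)
  then show ?thesis using c by (simp add: cong_dvd_iff)
qed

text \<open>With \<open>P\<close> the product over \<open>J\<close> and \<open>Q\<close> the
  complementary product, \<open>D\<close> divides \<open>Q\<close>, so \<open>P * n!\<close> is at
  most \<open>r ^ v * P * Q\<close>, hence at most \<open>r ^ v * r ^ n * (n + 1)!\<close>. After
  cancelling \<open>n!\<close>, the factors \<open>r ^ v\<close>, \<open>r ^ n\<close> and
  \<open>n + 1\<close> are each at most \<open>r ^ n\<close>, whence the exponent
  \<open>3 * n\<close>.\<close>

lemma prod_primes_progression_le:
  fixes r n :: nat
  assumes r: "prime r" and J: "J \<subseteq> {1..n}" "\<And>j. j \<in> J \<Longrightarrow> prime (r * j + 1) \<and> n < r * j + 1"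
  shows "(\<Prod>j\<in>J. r * j + 1) \<le> r ^ (3 * n)"
proof -
  obtain v D where D: "fact n = r ^ v * D" "coprime D r" "v \<le> n"
    using fact_split_prime[OF r] by blast
  define P where "P = (\<Prod>j\<in>J. r * j + 1)"
  define Q where "Q = (\<Prod>j\<in>{1..n} - J. r * j + 1)"
  have r2: "2 \<le> r" using r by (rule prime_ge_2_nat)
  have PQ: "(\<Prod>j\<in>{1..n}. r * j + 1) = P * Q"
    unfolding P_def Q_def using J(1)
    by (subst prod.subset_diff[OF J(1)]) (auto simp: mult.commute)
  have "coprime D P"
    unfolding P_def
  proof (rule prod_coprime_right)
    fix j assume j: "j \<in> J"
    have "\<not> (r * j + 1) dvd fact n" using J(2)[OF j] by (subst prime_dvd_fact_iff) auto
    then have "\<not> (r * j + 1) dvd D" unfolding D(1) by auto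
    then show "coprime D (r * j + 1)" using J(2)[OF j] prime_imp_coprime coprime_commute by blast
  qed
  moreover have "D dvd P * Q"
    unfolding PQ[symmetric] using D by (intro coprime_dvd_fact_imp_dvd_prod) auto
  ultimately have "D dvd Q" by (simp add: coprime_dvd_mult_right_iff)
  moreover have "Q > 0" unfolding Q_def by (rule prod_pos) auto
  ultimately have DQ: "D \<le> Q" by (rule dvd_imp_le)
  have "P * fact n \<le> r ^ v * (P * Q)"
    unfolding D(1) using DQ by (simp add: mult.left_commute)
  also have "P * Q \<le> (\<Prod>j\<in>{1..n}. r * (j + 1))"
    unfolding PQ[symmetric] using r2 by (intro prod_mono) auto
  also have "\<dots> = r ^ n * fact (Suc n)"
    by (induction n) (auto simp: algebra_simps)
  also have "r ^ v * (r ^ n * fact (Suc n)) = r ^ v * r ^ n * Suc n * fact n"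
    by (simp add: algebra_simps)
  finally have "P * fact n \<le> r ^ v * r ^ n * Suc n * fact n" by simp
  then have "P \<le> r ^ v * r ^ n * Suc n" by simp
  also have "\<dots> \<le> r ^ n * r ^ n * r ^ n"
  proof (intro mult_mono power_increasing D)
    have "n < 2 ^ n" by (rule less_exp)
    also have "(2::nat) ^ n \<le> r ^ n" using r2 by (rule power_mono) auto
    finally show "Suc n \<le> r ^ n" by simp
  qed (use r2 in auto)
  also have "\<dots> = r ^ (3 * n)" 
    unfolding power_add[symmetric] by (rule arg_cong[where f = "power r"]) simp
  finally show ?thesis unfolding P_def .
qed

section \<open>Counting primes in dyadic blocks\<close>

definition pblock :: "nat \<Rightarrow> nat set" where
  "pblock k = {p. prime p \<and> 2 ^ k \<le> p \<and> p < 2 ^ Suc k}"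

lemma finite_pblock [simp]: "finite (pblock k)"
  by (rule finite_subset[of _ "{..<2 ^ Suc k :: nat}"]) (auto simp: pblock_def)

text \<open>Each prime counted is \<open>r * j + 1\<close> with
  \<open>1 \<le> j \<le> 2 ^ Suc k div r\<close> and is at least \<open>2 ^ k\<close>. The product
  bound thus puts \<open>2 ^ (k * card J)\<close> below a power of \<open>r\<close>; replacing
  \<open>r\<close> by \<open>2 ^ bitlen r\<close> and comparing exponents gives the count.\<close>

lemma card_pblock_progression:
  assumes r: "prime r" and k: "1 \<le> k"
  shows "k * card {p \<in> pblock k. r dvd p - 1} \<le> 3 * (2 ^ Suc k div r) * bitlen r"
proof -
  define n where "n = 2 ^ Suc k div r"
  define J where "J = {j\<in>{1..n}. r * j + 1 \<in> pblock k}"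
  have r2: "2 \<le> r" using r by (rule prime_ge_2_nat)
  have img: "{p \<in> pblock k. r dvd p - 1} = (\<lambda>j. r * j + 1) ` J"
  proof safe
    fix p assume p: "p \<in> pblock k" "r dvd p - 1"
    then obtain j where j: "p - 1 = r * j" by (auto elim: dvdE)
    have p2: "2 \<le> p" "p < 2 ^ Suc k" using p(1) by (auto simp: pblock_def prime_ge_2_nat)
    then have pj: "p = r * j + 1" using j by simp
    then have "j \<ge> 1" using p2 by (cases j) auto
    moreover have "j \<le> n" unfolding n_def using r2 p2 pj by (simp add: less_eq_div_iff_mult_less_eq mult.commute)
    ultimately show "p \<in> (\<lambda>j. r * j + 1) ` J" using p pj by (auto simp: J_def)
  qed (auto simp: J_def)
  \<comment> \<open>For \<open>r \<ge> 3\<close> the length \<open>n\<close> is below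
    \<open>2 ^ k\<close>. For \<open>r = 2\<close> it equals \<open>2 ^ k\<close>, and strictness
    comes from parity: \<open>2 * j + 1\<close> is odd while \<open>2 ^ k\<close> is even.\<close>
  have gt: "n < r * j + 1" if j: "j \<in> J" for j
  proof (cases "r = 2")
    case True
    have "2 ^ k \<le> r * j + 1" "even ((2::nat) ^ k)" using j k by (auto simp: J_def pblock_def)
    then have "2 ^ k \<noteq> r * j + 1" using True by (metis dvd_triv_left even_plus_one_iff)
    then show ?thesis using \<open>2 ^ k \<le> r * j + 1\<close> True by (simp add: n_def)
  next
    case False
    then have "2 ^ Suc k < 2 ^ k * r" using r2 by simp
    then have "n < 2 ^ k" unfolding n_def using r2 by (simp add: div_less_iff_less_mult)
    then show ?thesis using j by (auto simp: J_def pblock_def)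
  qed
  have "(2::nat) ^ (k * card J) = (\<Prod>j\<in>J. 2 ^ k)" by (simp add: power_mult)
  also have "\<dots> \<le> (\<Prod>j\<in>J. r * j + 1)"
    by (rule prod_mono) (auto simp: J_def pblock_def)
  also have "\<dots> \<le> r ^ (3 * n)"
    using r gt by (intro prod_primes_progression_le) (auto simp: J_def pblock_def)
  also have "\<dots> \<le> (2 ^ bitlen r) ^ (3 * n)"
    using less_two_power_bitlen[of r] by (intro power_mono) auto
  also have "\<dots> = 2 ^ (3 * n * bitlen r)" by (simp add: mult.commute flip: power_mult)
  finally have "k * card J \<le> 3 * n * bitlen r" by simp
  moreover have "card {p \<in> pblock k. r dvd p - 1} = card J"
    unfolding img using r2 by (intro card_image) (auto simp: inj_on_def)
  ultimately show ?thesis by (simp add: n_def)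
qed

text \<open>The case \<open>r = 2\<close> of the progression bound covers the odd primes and gives
  \<open>6 * 2 ^ k\<close>. The prime 2 lies only in block 1 and adds at most 1.\<close>

lemma card_pblock:
  assumes k: "1 \<le> k"
  shows "k * card (pblock k) \<le> 7 * 2 ^ k"
proof -
  have sub: "pblock k \<subseteq> {p \<in> pblock k. 2 dvd p - 1} \<union> (if k = 1 then {2} else {})"
  proof
    fix p assume p: "p \<in> pblock k"
    show "p \<in> {p \<in> pblock k. 2 dvd p - 1} \<union> (if k = 1 then {2} else {})"
    proof (cases "p = 2")
      case True
      then have "(2::nat) ^ k \<le> 2 ^ 1" using p by (simp add: pblock_def)
      then have "k \<le> 1" by (subst (asm) power_increasing_iff) auto
      then show ?thesis using True k by auto
    next
      case False
      then have "odd p" using p prime_odd_nat[of p] prime_ge_2_nat[of p] by (auto simp: pblock_def)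
      then show ?thesis using p by auto
    qed
  qed
  have "card (pblock k) \<le> card {p \<in> pblock k. 2 dvd p - 1} + card (if k = 1 then {2::nat} else {})"
    by (rule order.trans[OF card_mono[OF _ sub] card_Un_le]) auto
  then have "k * card (pblock k) \<le> k * card {p \<in> pblock k. 2 dvd p - 1} + k * card (if k = 1 then {2::nat} else {})"
    by (metis distrib_left mult_le_mono2)
  also have "k * card (if k = 1 then {2::nat} else {}) \<le> 1" by simp
  also have "k * card {p \<in> pblock k. 2 dvd p - 1} \<le> 6 * 2 ^ k"
    using card_pblock_progression[of 2 k] k by (simp add: bitlen.simps)
  finally show ?thesis using one_le_power[of "2::nat" k] by linarith
qed

section \<open>Sums over the primes up to \<open>x\<close>\<close>

text \<open>A prime \<open>p\<close> lies in the block with index \<open>bitlen p - 1\<close>, so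
  the blocks are disjoint and cover the range. The last block may contain primes beyond
  \<open>x\<close>, which nonnegativity of \<open>g\<close> absorbs.\<close>

lemma sum_primes_le_blocks:
  fixes g :: "nat \<Rightarrow> real"
  assumes "\<And>p. 0 \<le> g p"
  shows "(\<Sum>p | prime p \<and> p \<le> x. g p) \<le> (\<Sum>k=1..bitlen x - 1. \<Sum>p\<in>pblock k. g p)"
proof -
  have "(\<Sum>p | prime p \<and> p \<le> x. g p) \<le> (\<Sum>p\<in>(\<Union>k\<in>{1..bitlen x - 1}. pblock k). g p)"
  proof (rule sum_mono2)
    show "{p. prime p \<and> p \<le> x} \<subseteq> (\<Union>k\<in>{1..bitlen x - 1}. pblock k)"
    proof safe
      fix p assume p: "prime p" "p \<le> x"
      have "2 \<le> bitlen p" using p prime_ge_2_nat bitlen_two_le by blast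
      moreover have "bitlen p \<le> bitlen x" using p by (simp add: bitlen_mono)
      moreover have "p \<in> pblock (bitlen p - 1)"
        using p \<open>2 \<le> bitlen p\<close> two_power_le_of_bitlen[of p] less_two_power_bitlen[of p]
        by (auto simp: pblock_def prime_gt_0_nat)
      ultimately show "p \<in> (\<Union>k\<in>{1..bitlen x - 1}. pblock k)"
        by (intro UN_I[of "bitlen p - 1"]) auto
    qed
  qed (use assms in auto)
  also have "\<dots> = (\<Sum>k=1..bitlen x - 1. \<Sum>p\<in>pblock k. g p)"
  proof (intro sum.UNION_disjoint ballI impI)
    fix i j assume "i \<noteq> (j::nat)"
    show "pblock i \<inter> pblock j = {}"
    proof safe
      fix p assume "p \<in> pblock i" "p \<in> pblock j"
      then have "bitlen p = Suc i" "bitlen p = Suc j" by (auto simp: pblock_def intro!: bitlen_eqI)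
      then show "p \<in> {}" using \<open>i \<noteq> j\<close> by simp
    qed
  qed auto
  finally show ?thesis .
qed

text \<open>A block has at most \<open>7 * 2 ^ k / k\<close> primes, each contributing at most
  \<open>1 / 2 ^ k\<close>, so it contributes at most \<open>7 / k\<close>. This is the upper half
  of Mertens' theorem, since \<open>harm (bitlen x)\<close> has order log log x.\<close>

lemma sum_prime_inverse_le:
  "(\<Sum>p | prime p \<and> p \<le> x. 1 / real p) \<le> 7 * harm (bitlen x)"
proof -
  have "(\<Sum>p | prime p \<and> p \<le> x. 1 / real p) \<le> (\<Sum>k=1..bitlen x - 1. \<Sum>p\<in>pblock k. 1 / real p)"
    by (rule sum_primes_le_blocks) auto
  also have "\<dots> \<le> (\<Sum>k=1..bitlen x - 1. 7 * inverse (real k))"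
  proof (rule sum_mono)
    fix k assume k: "k \<in> {1..bitlen x - 1}"
    have "(\<Sum>p\<in>pblock k. 1 / real p) \<le> (\<Sum>p\<in>pblock k. 1 / 2 ^ k)"
    proof (rule sum_mono)
      fix p assume "p \<in> pblock k"
      then have "real (2 ^ k) \<le> real p" unfolding of_nat_le_iff by (simp add: pblock_def)
      moreover have "0 < real (2 ^ k)" by simp
      ultimately have "0 < real p" by linarith
      then show "1 / real p \<le> 1 / 2 ^ k" using \<open>real (2 ^ k) \<le> real p\<close> by (intro divide_left_mono) auto
    qed
    also have "\<dots> = real (k * card (pblock k)) / (k * 2 ^ k)" using k by simp
    also have "\<dots> \<le> real (7 * 2 ^ k) / (k * 2 ^ k)"
      using k by (intro divide_right_mono of_nat_mono card_pblock) auto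
    also have "\<dots> = 7 * inverse (real k)" by (simp add: field_simps)
    finally show "(\<Sum>p\<in>pblock k. 1 / real p) \<le> 7 * inverse (real k)" .
  qed
  also have "\<dots> \<le> (\<Sum>k=1..bitlen x. 7 * inverse (real k))"
    by (rule sum_mono2) auto
  also have "\<dots> = 7 * harm (bitlen x)" by (simp add: harm_def sum_distrib_left)
  finally show ?thesis .
qed

text \<open>Primes in block \<open>k\<close> have bit length \<open>k + 1\<close>, which is at most
  \<open>2 * k\<close>, so the factor \<open>k\<close> cancels the denominator in the prime count
  and leaves \<open>14 * 2 ^ k\<close>. The geometric sum stays below
  \<open>28 * 2 ^ (bitlen x - 1)\<close>.\<close>

lemma sum_prime_bitlen_le:
  assumes "1 \<le> x"
  shows "(\<Sum>p | prime p \<and> p \<le> x. bitlen p) \<le> 28 * x"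
proof -
  have "(\<Sum>p | prime p \<and> p \<le> x. real (bitlen p)) \<le> (\<Sum>k=1..bitlen x - 1. \<Sum>p\<in>pblock k. real (bitlen p))"
    by (rule sum_primes_le_blocks) auto
  also have "\<dots> \<le> (\<Sum>k=1..bitlen x - 1. 14 * 2 ^ k)"
  proof (rule sum_mono)
    fix k assume k: "k \<in> {1..bitlen x - 1}"
    have "(\<Sum>p\<in>pblock k. bitlen p) = (\<Sum>p\<in>pblock k. Suc k)"
      by (rule sum.cong) (auto simp: pblock_def intro!: bitlen_eqI)
    also have "\<dots> = Suc k * card (pblock k)" by simp
    also have "\<dots> \<le> (2 * k) * card (pblock k)" using k by (intro mult_right_mono) auto
    also have "\<dots> \<le> 14 * 2 ^ k" using card_pblock[of k] k by simp
    finally have "real (\<Sum>p\<in>pblock k. bitlen p) \<le> real (14 * 2 ^ k)" by (rule of_nat_mono)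
    then show "(\<Sum>p\<in>pblock k. real (bitlen p)) \<le> 14 * 2 ^ k" by simp
  qed
  also have "\<dots> \<le> (\<Sum>k<bitlen x. 14 * 2 ^ k)" 
    using bitlen_pos[of x] by (intro sum_mono2) auto
  also have "\<dots> = 14 * (2 ^ bitlen x - 1)"
    by (simp add: sum_gp_strict flip: sum_distrib_left)
  also have "\<dots> \<le> 28 * real (2 ^ (bitlen x - 1))"
    using bitlen_pos[of x] by (cases "bitlen x") auto
  also have "\<dots> \<le> 28 * real x"
    using assms by (intro mult_left_mono of_nat_mono two_power_le_of_bitlen) auto
  finally have "real (\<Sum>p | prime p \<and> p \<le> x. bitlen p) \<le> real (28 * x)" by simp
  then show ?thesis by (simp only: of_nat_le_iff)
qed

lemma bitlen_le_ln: 
  assumes "1 \<le> x"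
  shows "real (bitlen x) \<le> 1 + ln (real x) / ln 2"
proof -
  have "real (bitlen x - 1) * ln 2 = ln (real (2 ^ (bitlen x - 1)))"
    by (simp add: ln_realpow)
  also have "\<dots> \<le> ln (real x)"
    using two_power_le_of_bitlen[of x] assms by (intro ln_mono of_nat_mono) auto
  finally show ?thesis using bitlen_pos[of x] by (simp add: field_simps)
qed

lemma summable_bitlen_div_square: "summable (\<lambda>r. real (bitlen r) / real r ^ 2)"
proof (rule summable_comparison_test_bigo)
  \<comment> \<open>Any exponent strictly between 1 and 2 would do: the series still converges and
    the gap to 2 absorbs the logarithm.\<close>
  show "summable (\<lambda>n. norm (real n powr (-3/2)))"
    by (simp add: summable_real_powr_iff)
  have "(\<lambda>r. real (bitlen r) / real r ^ 2) \<in> O(\<lambda>r. (1 + ln (real r) / ln 2) / real r ^ 2)"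
    by (intro landau_o.big_mono eventually_mono[OF eventually_ge_at_top[of 1]])
       (auto intro!: divide_right_mono order.trans[OF bitlen_le_ln] simp: abs_mult)
  also have "(\<lambda>r. (1 + ln (real r) / ln 2) / real r ^ 2) \<in> O(\<lambda>n. real n powr (-3/2))"
    by real_asymp
  finally show "(\<lambda>r. real (bitlen r) / real r ^ 2) \<in> O(\<lambda>n. real n powr (-3/2))" .
qed

text \<open>The term at \<open>r = 0\<close> vanishes because division by zero gives 0. The value
  stays unevaluated and enters the final bound as a constant.\<close>

definition bitlen_const :: real where
  "bitlen_const = (\<Sum>r. real (bitlen r) / real r ^ 2)"

text \<open>Within a block, swapping the sums leaves for each \<open>r\<close> the number of
  \<open>p\<close> with \<open>r dvd p - 1\<close>, weighted by \<open>1 / (2 ^ k * r)\<close>. The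
  progression bound turns this into \<open>6 * bitlen r / (k * r ^ 2)\<close>, and summing over
  \<open>r\<close> gives at most \<open>6 * bitlen_const / k\<close>.\<close>

lemma sum_prime_pairs_le:
  "(\<Sum>p | prime p \<and> p \<le> x. \<Sum>r | prime r \<and> r dvd p - 1. 1 / (real p * real r))
     \<le> 6 * bitlen_const * harm (bitlen x)"
proof -
  \<comment> \<open>A finite range of \<open>r\<close>, the same for all \<open>p\<close> in the
    block, which permits the exchange of summation; it contains every prime divisor of
    \<open>p - 1\<close>.\<close>
  define R where "R k = {r::nat. prime r \<and> r < 2 ^ Suc k}" for k :: nat
  have finR [simp]: "finite (R k)" for k
    by (rule finite_subset[of _ "{..<2 ^ Suc k :: nat}"]) (auto simp: R_def)
  have C0: "0 \<le> bitlen_const" unfolding bitlen_const_def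
    by (intro suminf_nonneg summable_bitlen_div_square) auto
  have "(\<Sum>p | prime p \<and> p \<le> x. \<Sum>r | prime r \<and> r dvd p - 1. 1 / (real p * real r))
      \<le> (\<Sum>k=1..bitlen x - 1. \<Sum>p\<in>pblock k. \<Sum>r | prime r \<and> r dvd p - 1. 1 / (real p * real r))"
    by (rule sum_primes_le_blocks) (auto intro!: sum_nonneg)
  also have "\<dots> \<le> (\<Sum>k=1..bitlen x - 1. 6 * bitlen_const * inverse (real k))"
  proof (rule sum_mono)
    fix k assume k: "k \<in> {1..bitlen x - 1}"
    have "(\<Sum>p\<in>pblock k. \<Sum>r | prime r \<and> r dvd p - 1. 1 / (real p * real r))
        \<le> (\<Sum>p\<in>pblock k. \<Sum>r | r \<in> R k \<and> r dvd p - 1. 1 / (2 ^ k * real r))"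
    proof (rule sum_mono)
      fix p assume p: "p \<in> pblock k"
      have p2: "2 \<le> p" using p by (auto simp: pblock_def prime_ge_2_nat)
      have "{r. prime r \<and> r dvd p - 1} \<subseteq> {r. r \<in> R k \<and> r dvd p - 1}"
      proof safe
        fix r assume "prime r" "r dvd p - 1"
        then have "r \<le> p - 1" using p2 by (intro dvd_imp_le) auto
        then show "r \<in> R k" using p \<open>prime r\<close> by (auto simp: R_def pblock_def)
      qed
      then have eq: "{r. prime r \<and> r dvd p - 1} = {r. r \<in> R k \<and> r dvd p - 1}"
        by (auto simp: R_def)
      show "(\<Sum>r | prime r \<and> r dvd p - 1. 1 / (real p * real r)) 
         \<le> (\<Sum>r | r \<in> R k \<and> r dvd p - 1. 1 / (2 ^ k * real r))"
        unfolding eq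
      proof (rule sum_mono)
        fix r assume "r \<in> {r. r \<in> R k \<and> r dvd p - 1}"
        then have "0 < r" by (auto simp: R_def prime_gt_0_nat)
        moreover have "real (2 ^ k) \<le> real p" using p unfolding of_nat_le_iff by (simp add: pblock_def)
        ultimately show "1 / (real p * real r) \<le> 1 / (2 ^ k * real r)"
          using p2 by (intro divide_left_mono mult_right_mono) auto
      qed
    qed
    also have "\<dots> = (\<Sum>r\<in>R k. \<Sum>p | p \<in> pblock k \<and> r dvd p - 1. 1 / (2 ^ k * real r))"
      using sum.swap_restrict[of "pblock k" "R k" "\<lambda>p r. 1 / (2 ^ k * real r)" "\<lambda>p r. r dvd p - 1"]
      by simp
    also have "\<dots> \<le> (\<Sum>r\<in>R k. 6 * inverse (real k) * (real (bitlen r) / real r ^ 2))"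
    proof (rule sum_mono)
      fix r assume r: "r \<in> R k"
      then have pr: "prime r" "0 < r" by (auto simp: R_def prime_gt_0_nat)
      have "real (k * card {p \<in> pblock k. r dvd p - 1}) \<le> real (3 * (2 ^ Suc k div r) * bitlen r)"
        using pr k by (intro of_nat_mono card_pblock_progression) auto
      also have "\<dots> = 3 * real (2 ^ Suc k div r) * real (bitlen r)" by simp
      also have "\<dots> \<le> 3 * (real (2 ^ Suc k) / real r) * real (bitlen r)"
        by (intro mult_right_mono mult_left_mono of_nat_div_le_of_nat) auto
      finally have *: "real k * card {p \<in> pblock k. r dvd p - 1} \<le> 6 * 2 ^ k / real r * real (bitlen r)"
        by simp
      have "(\<Sum>p | p \<in> pblock k \<and> r dvd p - 1. 1 / (2 ^ k * real r)) 
          = (real k * card {p \<in> pblock k. r dvd p - 1}) / (real k * 2 ^ k * real r)"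
        using k by (simp add: field_simps)
      also have "\<dots> \<le> (6 * 2 ^ k / real r * real (bitlen r)) / (real k * 2 ^ k * real r)"
        by (intro divide_right_mono *) auto
      also have "\<dots> = 6 * inverse (real k) * (real (bitlen r) / real r ^ 2)"
        using k pr by (simp add: field_simps power2_eq_square)
      finally show "(\<Sum>p | p \<in> pblock k \<and> r dvd p - 1. 1 / (2 ^ k * real r))
          \<le> 6 * inverse (real k) * (real (bitlen r) / real r ^ 2)" .
    qed
    also have "\<dots> = 6 * inverse (real k) * (\<Sum>r\<in>R k. real (bitlen r) / real r ^ 2)"
      by (simp add: sum_distrib_left)
    also have "\<dots> \<le> 6 * inverse (real k) * bitlen_const"
      unfolding bitlen_const_def
      by (intro mult_left_mono sum_le_suminf summable_bitlen_div_square) auto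
    finally show "(\<Sum>p\<in>pblock k. \<Sum>r | prime r \<and> r dvd p - 1. 1 / (real p * real r))
        \<le> 6 * bitlen_const * inverse (real k)" by (simp add: mult_ac)
  qed
  also have "\<dots> \<le> (\<Sum>k=1..bitlen x. 6 * bitlen_const * inverse (real k))"
    using C0 by (intro sum_mono2) auto
  also have "\<dots> = 6 * bitlen_const * harm (bitlen x)" by (simp add: harm_def sum_distrib_left)
  finally show ?thesis .
qed

subsection \<open>Invariants of the machine\<close>

lemma bitlen_small [simp]:
  "bitlen 0 = 1" "bitlen (Suc 0) = 1" "bitlen 1 = 1" "bitlen 2 = 2" "bitlen 3 = 2" "bitlen 4 = 3"
  by (simp_all add: bitlen.simps)

lemma tick_simps [simp]:
  "sF (tick c s) = sF s" "sV (tick c s) = sV s" "sfl (tick c s) = sfl s" "cnt (tick c s) = cnt s"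
  "cost (tick c s) = cost s + c" "pcells (tick c s) = pcells s" "pval (tick c s) = pval s"
  by (simp_all add: tick_def)

lemma wrF_simps [simp]:
  "sF (wrF i v s) = (sF s)[i := v]" "sV (wrF i v s) = sV s" "sfl (wrF i v s) = sfl s"
  "cnt (wrF i v s) = cnt s" "cost (wrF i v s) = cost s + (bitlen i + bitlen v)"
  "pcells (wrF i v s) = pcells s" "pval (wrF i v s) = max (pval s) v"
  by (simp_all add: wrF_def)

lemma wrV_simps [simp]:
  "sV (wrV i v s) = (sV s)[i := v]" "sF (wrV i v s) = sF s" "sfl (wrV i v s) = sfl s"
  "cnt (wrV i v s) = cnt s" "cost (wrV i v s) = cost s + (bitlen i + bitlen v)"
  "pcells (wrV i v s) = pcells s" "pval (wrV i v s) = max (pval s) v"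
  by (simp_all add: wrV_def)

lemma push_fl_simps [simp]:
  "sV (push_fl q s) = sV s" "sF (push_fl q s) = sF s" "sfl (push_fl q s) = sfl s @ [q]"
  "cnt (push_fl q s) = cnt s" "cost (push_fl q s) = cost s + (bitlen (length (sfl s)) + bitlen q)"
  "pcells (push_fl q s) = max (pcells s) (length (sF s) + length (sV s) + (length (sfl s) + 1))"
  "pval (push_fl q s) = max (pval s) q"
  by (simp_all add: push_fl_def note_cells_def)

text \<open>Rule for counting loops: the invariant may mention the index about to be processed, and
  \<open>c k\<close> is a state-independent budget for iteration \<open>k\<close>, so that costs add
  up to a plain sum.\<close>

lemma fold_upt_invariant:
  assumes "I a s" "a \<le> b"
    and "\<And>k s. a \<le> k \<Longrightarrow> k < b \<Longrightarrow> I k s \<Longrightarrow> I (Suc k) (f k s) \<and> cost (f k s) \<le> cost s + c k"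
  shows "I b (fold f [a..<b] s) \<and> cost (fold f [a..<b] s) \<le> cost s + (\<Sum>k=a..<b. c k)"
  using assms(2,3)
proof (induction b rule: dec_induct)
  case base
  then show ?case using assms(1) by simp
next
  case (step b)
  let ?t = "fold f [a..<b] s"
  have IH: "I b ?t" "cost ?t \<le> cost s + (\<Sum>k=a..<b. c k)" using step by auto
  have "I (Suc b) (f b ?t)" "cost (f b ?t) \<le> cost ?t + c b" using step IH by auto
  then show ?case using IH step.hyps by simp
qed

text \<open>Variant for the factor list: distinctness makes the cost a sum over a set, which can
  then be enlarged to all prime divisors of \<open>p - 1\<close>.\<close>

lemma fold_distinct_invariant:
  assumes "I s" "distinct xs"
    and "\<And>a s. a \<in> set xs \<Longrightarrow> I s \<Longrightarrow> I (f a s) \<and> cost (f a s) \<le> cost s + c a"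
  shows "I (fold f xs s) \<and> cost (fold f xs s) \<le> cost s + (\<Sum>a\<in>set xs. c a)"
  using assms
proof (induction xs arbitrary: s)
  case (Cons a xs)
  have Ia: "I (f a s)" "cost (f a s) \<le> cost s + c a" using Cons.prems by auto
  have "I (fold f xs (f a s)) \<and> cost (fold f xs (f a s)) \<le> cost (f a s) + (\<Sum>a\<in>set xs. c a)"
    using Cons.prems Ia by (intro Cons.IH) auto
  moreover have "(\<Sum>a\<in>set (a # xs). c a) = c a + (\<Sum>a\<in>set xs. c a)" using Cons.prems by simp
  ultimately show ?case using Ia by auto
qed simp

text \<open>The cell budget grants \<open>2 * (x + 1)\<close> to the two arrays and as much again to
  the factor list. Entries of \<open>sV\<close> stay at most 2, so reading them is cheap; the
  counter is touched only in the last step.\<close>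

definition inv_st :: "nat \<Rightarrow> st \<Rightarrow> bool" where
  "inv_st x s \<longleftrightarrow> length (sF s) = x + 1 \<and> length (sV s) = x + 1 \<and> (\<forall>i\<le>x. sV s ! i \<le> 2) \<and>
     cnt s = 0 \<and> pval s \<le> x \<and> pcells s \<le> 4 * (x + 1)"

lemma inv_st_tick [simp]: "inv_st x (tick c s) = inv_st x s"
  by (simp add: inv_st_def)

lemma inv_st_sfl [simp]: "inv_st x (s\<lparr>sfl := l\<rparr>) = inv_st x s"
  by (simp add: inv_st_def)

lemma inv_st_wrV: "inv_st x s \<Longrightarrow> v \<le> 2 \<Longrightarrow> 2 \<le> x \<Longrightarrow> inv_st x (wrV i v s)"
proof -
  assume a: "inv_st x s" "v \<le> 2" "2 \<le> x"
  then have "(sV s)[i := v] ! j \<le> 2" if "j \<le> x" for j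
    using that by (cases "i = j") (auto simp: inv_st_def)
  then show ?thesis using a by (auto simp: inv_st_def)
qed

lemma inv_st_wrF: "inv_st x s \<Longrightarrow> v \<le> x \<Longrightarrow> inv_st x (wrF i v s)"
  by (auto simp: inv_st_def)

section \<open>Contents of the sieve array\<close>

text \<open>Largest prime factor of \<open>n\<close> below \<open>m\<close>: what cell
  \<open>n\<close> holds just before candidate \<open>m\<close> is processed. The inserted 0 is the
  mark of an untouched cell and makes the maximum well defined.\<close>

definition lpf :: "nat \<Rightarrow> nat \<Rightarrow> nat" where
  "lpf m n = Max (insert 0 {q. prime q \<and> q < m \<and> q dvd n})"

lemma lpf_cases:
  "lpf m n = 0 \<and> (\<forall>q. prime q \<longrightarrow> q < m \<longrightarrow> \<not> q dvd n) \<or>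
   prime (lpf m n) \<and> lpf m n < m \<and> lpf m n dvd n \<and> (\<forall>q. prime q \<longrightarrow> q < m \<longrightarrow> q dvd n \<longrightarrow> q \<le> lpf m n)"
proof -
  let ?A = "{q. prime q \<and> q < m \<and> q dvd n}"
  have fin: "finite (insert 0 ?A)" by auto
  have le: "q \<le> lpf m n" if "prime q" "q < m" "q dvd n" for q
    unfolding lpf_def using that by (intro Max_ge fin) auto
  have "lpf m n \<in> insert 0 ?A" unfolding lpf_def by (intro Max_in fin) auto
  then consider "lpf m n = 0" | "lpf m n \<in> ?A" by (elim insertE)
  then show ?thesis
  proof cases
    case 1
    then have "\<not> q dvd n" if "prime q" "q < m" for q using le[OF that] prime_gt_0_nat[OF that(1)] by auto
    then show ?thesis using 1 by blast
  next
    case 2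
    then show ?thesis using le by blast
  qed
qed

lemma lpf_Suc_prime: "prime p \<Longrightarrow> lpf (Suc p) n = (if p dvd n then p else lpf p n)"
proof -
  assume p: "prime p"
  show ?thesis
  proof (cases "p dvd n")
    case True
    then show ?thesis unfolding lpf_def using p by (auto intro!: Max_eqI)
  next
    case False
    then have "{q. prime q \<and> q < Suc p \<and> q dvd n} = {q. prime q \<and> q < p \<and> q dvd n}"
      by (auto simp: less_Suc_eq)
    then show ?thesis using False by (simp add: lpf_def)
  qed
qed

lemma lpf_Suc_not_prime: "\<not> prime p \<Longrightarrow> lpf (Suc p) n = lpf p n"
proof -
  assume "\<not> prime p"
  then have "{q. prime q \<and> q < Suc p \<and> q dvd n} = {q. prime q \<and> q < p \<and> q dvd n}"
    by (auto simp: less_Suc_eq)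
  then show ?thesis by (simp add: lpf_def)
qed

text \<open>If \<open>p\<close> has no prime factor below itself, its only prime factor is
  \<open>p\<close>. Hence the sieve recognises primes by their unmarked cells.\<close>

lemma lpf_self_eq_0_iff:
  assumes "2 \<le> p"
  shows "lpf p p = 0 \<longleftrightarrow> prime p"
proof
  assume "lpf p p = 0"
  then have no: "\<not> q dvd p" if "prime q" "q < p" for q using lpf_cases[of p p] that by auto
  obtain q where q: "prime q" "q dvd p" using prime_factor_nat[of p] assms by auto
  moreover have "q \<le> p" using q assms by (intro dvd_imp_le) auto
  ultimately show "prime p" using no[of q] by (cases "q = p") auto
next
  assume "prime p"
  then show "lpf p p = 0" using lpf_cases[of p p] by (metis less_irrefl not_prime_0 prime_nat_iff)
qed

text \<open>The finished array. The bound on the prime factors is \<open>q * q \<le> x\<close> and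
  not \<open>q * q \<le> n\<close>, so the entry 0 remains exactly at 1 and at the primes above the
  square root of \<open>x\<close>.\<close>

definition sieved :: "nat \<Rightarrow> nat list \<Rightarrow> bool" where
  "sieved x F \<longleftrightarrow> (\<forall>n. 1 \<le> n \<longrightarrow> n \<le> x \<longrightarrow>
     F ! n = 0 \<and> (\<forall>q. prime q \<longrightarrow> q * q \<le> x \<longrightarrow> \<not> q dvd n) \<or>
     prime (F ! n) \<and> F ! n * F ! n \<le> x \<and> F ! n dvd n \<and>
       (\<forall>q. prime q \<longrightarrow> q * q \<le> x \<longrightarrow> q dvd n \<longrightarrow> q \<le> F ! n))"

lemma sieved_cases:
  assumes "sieved x F" "1 \<le> n" "n \<le> x"
  obtains "F ! n = 0" "\<And>q. prime q \<Longrightarrow> q * q \<le> x \<Longrightarrow> \<not> q dvd n"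
  | "prime (F ! n)" "0 < F ! n" "F ! n * F ! n \<le> x" "F ! n dvd n"
    "\<And>q. prime q \<Longrightarrow> q * q \<le> x \<Longrightarrow> q dvd n \<Longrightarrow> q \<le> F ! n"
proof -
  have "F ! n = 0 \<and> (\<forall>q. prime q \<longrightarrow> q * q \<le> x \<longrightarrow> \<not> q dvd n) \<or>
     prime (F ! n) \<and> F ! n * F ! n \<le> x \<and> F ! n dvd n \<and>
       (\<forall>q. prime q \<longrightarrow> q * q \<le> x \<longrightarrow> q dvd n \<longrightarrow> q \<le> F ! n)"
    using assms unfolding sieved_def by blast
  then show ?thesis using that prime_gt_0_nat[of "F ! n"] by (elim disjE) simp_all
qed

text \<open>Trial division: in a factorization \<open>n = d * e\<close> the smaller factor has
  square at most \<open>n\<close>, and so does each of its prime factors.\<close>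

lemma prime_if_no_small_factor:
  fixes n :: nat
  assumes "2 \<le> n" "n \<le> x" "\<And>q. prime q \<Longrightarrow> q * q \<le> x \<Longrightarrow> \<not> q dvd n"
  shows "prime n"
proof (rule ccontr)
  assume "\<not> prime n"
  then obtain d where d: "d dvd n" "d \<noteq> 1" "d \<noteq> n" using assms(1) by (auto simp: prime_nat_iff)
  then obtain e where e: "n = d * e" by (elim dvdE)
  have "e \<noteq> 1" "e > 0" "d > 0" using d e assms(1) by (auto intro: gr0I)
  have small: False if f: "f dvd n" "f \<noteq> 1" "f * f \<le> n" for f
  proof -
    obtain q where q: "prime q" "q dvd f" using prime_factor_nat f(2) by blast
    have "f > 0" using f(1) assms(1) by (auto intro: gr0I)
    then have "q \<le> f" using q by (intro dvd_imp_le)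
    then have "q * q \<le> f * f" by (rule mult_le_mono) (rule \<open>q \<le> f\<close>)
    then have "q * q \<le> x" using f assms by linarith
    then show False using assms(3)[OF q(1)] q(2) f(1) dvd_trans by blast
  qed
  show False
  proof (cases "d \<le> e")
    case True
    then show ?thesis using small[of d] d e by simp
  next
    case False
    then show ?thesis using small[of e] e \<open>e \<noteq> 1\<close> by simp
  qed
qed

lemma sieved_le:
  assumes "sieved x F" "1 \<le> n" "n \<le> x"
  shows "F ! n \<le> n"
  using assms by (cases rule: sieved_cases[OF assms]) (auto intro: dvd_imp_le)

text \<open>An entry 0 leaves no small prime factor, so \<open>p\<close> is prime; otherwise the
  entry is a prime divisor of \<open>p\<close>, equal to \<open>p\<close> exactly when
  \<open>p\<close> is prime. This makes the test \<open>is_primeF\<close> correct.\<close>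

lemma sieved_prime_iff:
  assumes "sieved x F" "2 \<le> p" "p \<le> x"
  shows "F ! p = 0 \<or> F ! p = p \<longleftrightarrow> prime p"
proof -
  have "1 \<le> p" using assms by simp
  show ?thesis
  proof (cases rule: sieved_cases[OF assms(1) \<open>1 \<le> p\<close> assms(3)])
    case 1
    then show ?thesis using prime_if_no_small_factor[of p x] assms by blast
  next
    case 2
    then show ?thesis by (metis less_numeral_extra(3) primes_dvd_imp_eq)
  qed
qed

subsection \<open>Factorisation by lookup\<close>

text \<open>Since the small prime factors are found in non-increasing order, comparing with the last
  recorded one suffices to keep the list free of duplicates; the prime above the square root,
  if any, comes last.\<close>
definition fact_inv :: "nat \<Rightarrow> nat \<Rightarrow> nat \<Rightarrow> nat list \<Rightarrow> bool" where
  "fact_inv x N m l \<longleftrightarrow> distinct l \<and> (\<forall>q\<in>set l. prime q \<and> q dvd N) \<and>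
     (\<forall>q\<in>set l. q \<noteq> last l \<longrightarrow> \<not> q dvd m) \<and>
     (l \<noteq> [] \<longrightarrow> 1 < m \<longrightarrow> last l * last l \<le> x \<and> (\<forall>t. prime t \<longrightarrow> t dvd m \<longrightarrow> t * t \<le> x \<longrightarrow> t \<le> last l))"

text \<open>Either \<open>q\<close> is the largest prime factor of \<open>m\<close> with square at
  most \<open>x\<close>, or \<open>m\<close> itself is a prime with square above \<open>x\<close>
  and the quotient is 1. The second case ends the loop, which is why the invariant bounds
  \<open>last l\<close> only while \<open>1 < m\<close>.\<close>

lemma fact_inv_step:
  assumes F: "sieved x F" and m: "2 \<le> m" "m \<le> x" "m dvd N" and inv: "fact_inv x N m l"
    and q: "q = (if F ! m = 0 then m else F ! m)"
  shows "prime q" "q dvd m"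
    "fact_inv x N (m div q) (if l \<noteq> [] \<and> last l = q then l else l @ [q])"
proof -
  have m1: "1 \<le> m" using m by simp
  consider (large) "prime m" "q = m" "x < m * m"
    | (small) "prime q" "q * q \<le> x" "q dvd m" "\<And>t. prime t \<Longrightarrow> t * t \<le> x \<Longrightarrow> t dvd m \<Longrightarrow> t \<le> q"
  proof (cases rule: sieved_cases[OF F m1 m(2)])
    case 1
    have "prime m" using 1 m prime_if_no_small_factor[of m x] by blast
    moreover have "x < m * m" using 1(2)[OF \<open>prime m\<close>] by (meson dvd_refl not_le)
    ultimately show ?thesis using 1 q large by simp
  next
    case 2
    then show ?thesis using small q by simp
  qed
  note cases = this
  show pq: "prime q" and dq: "q dvd m" by (cases rule: cases; simp)+
  have dv: "m div q dvd m" using dq by (metis dvd_def dvd_mult_div_cancel dvd_triv_right)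
  have qN: "q dvd N" using dq m(3) by (rule dvd_trans)
  have l: "distinct l" "\<And>t. t \<in> set l \<Longrightarrow> prime t" "\<And>t. t \<in> set l \<Longrightarrow> t dvd N"
    "\<And>t. t \<in> set l \<Longrightarrow> t \<noteq> last l \<Longrightarrow> \<not> t dvd m"
    "l \<noteq> [] \<Longrightarrow> last l * last l \<le> x"
    "\<And>t. l \<noteq> [] \<Longrightarrow> prime t \<Longrightarrow> t dvd m \<Longrightarrow> t * t \<le> x \<Longrightarrow> t \<le> last l"
    using inv m unfolding fact_inv_def by auto
  show "fact_inv x N (m div q) (if l \<noteq> [] \<and> last l = q then l else l @ [q])"
  proof (cases "l \<noteq> [] \<and> last l = q")
    case True
    moreover have "fact_inv x N (m div q) l"
      unfolding fact_inv_def
    proof (intro conjI ballI impI allI)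
      fix t assume "t \<in> set l" "t \<noteq> last l"
      then show "\<not> t dvd m div q" using l(4) dvd_trans[OF _ dv] by blast
    next
      fix t assume "l \<noteq> []" "prime t" "t dvd m div q" "t * t \<le> x"
      then show "t \<le> last l" using l(6) dvd_trans[OF _ dv] by blast
    qed (use l in auto)
    ultimately show ?thesis by simp
  next
    case False
    have notin: "q \<notin> set l"
    proof
      assume a: "q \<in> set l"
      then have "q = last l" using l(4)[of q] dq by blast
      then show False using False a by auto
    qed
    \<comment> \<open>A recorded \<open>t\<close> dividing \<open>m\<close> must be
      \<open>last l\<close>. Maximality of \<open>q\<close> gives \<open>t \<le> q\<close> and the
      invariant gives \<open>q \<le> t\<close>, so \<open>t = q\<close>, which this case
      excludes.\<close>
    have last: "\<not> t dvd m div q" if t: "t \<in> set l" for t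
    proof (cases rule: cases)
      case large
      then have "m div q = 1" using m by simp
      then show ?thesis using l(2)[OF t] by (auto simp: not_prime_1)
    next
      case small
      have "\<not> t dvd m"
      proof
        assume td: "t dvd m"
        have tl: "t = last l" "l \<noteq> []" using l(4)[OF t] td t by auto
        have "t \<le> q" using small(4)[OF l(2)[OF t] _ td] l(5) tl by simp
        moreover have "q \<le> t" using l(6)[OF tl(2) small(1,3,2)] tl by simp
        ultimately show False using False tl by simp
      qed
      then show ?thesis using dvd_trans[OF _ dv] by blast
    qed
    have "q * q \<le> x \<and> (\<forall>t. prime t \<longrightarrow> t dvd m div q \<longrightarrow> t * t \<le> x \<longrightarrow> t \<le> q)" if gt: "1 < m div q"
    proof (cases rule: cases)
      case large
      then show ?thesis using gt m by simp
    next
      case small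
      then show ?thesis using dvd_trans[OF _ dv] by auto
    qed
    then have "fact_inv x N (m div q) (l @ [q])"
      unfolding fact_inv_def using l notin last pq qN by auto
    then show ?thesis using False by auto
  qed
qed

lemma length_le_sum_bitlen: "length l \<le> sum_list (map bitlen l)"
proof (induction l)
  case (Cons a l)
  then show ?case using bitlen_pos[of a] by simp
qed simp

text \<open>The potential \<open>sum_list (map bitlen (sfl s)) + 2 * bitlen m\<close> never grows,
  by \<open>bitlen_div\<close>; it bounds both the length and the total bit size of the list by
  \<open>2 * B\<close>. \<open>B\<close> is fixed during the recursion, so the cost telescopes along
  \<open>bitlen m\<close>.\<close>

lemma fact_loop_spec:
  assumes "sieved x (sF s)" "1 \<le> m" "m \<le> x" "m dvd N" "fact_inv x N m (sfl s)" "inv_st x s"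
    "sum_list (map bitlen (sfl s)) + 2 * bitlen m \<le> 2 * B" "B \<le> bitlen x"
  shows "sF (fact_loop m s) = sF s \<and> inv_st x (fact_loop m s) \<and>
     distinct (sfl (fact_loop m s)) \<and> (\<forall>q\<in>set (sfl (fact_loop m s)). prime q \<and> q dvd N) \<and>
     sum_list (map bitlen (sfl (fact_loop m s))) \<le> 2 * B \<and>
     cost (fact_loop m s) \<le> cost s + 11 * B * bitlen m"
  using assms
proof (induction m arbitrary: s rule: less_induct)
  case (less m)
  have mB: "bitlen m \<le> B" using less.prems by linarith
  have B1: "1 \<le> B" using mB bitlen_pos[of m] by linarith
  show ?case
  proof (cases "m \<le> 1")
    case True
    then have "m = 1" using less.prems by simp
    then show ?thesis using less.prems B1
      by (subst (1 2 3 4 5 6) fact_loop.simps) (auto simp: fact_inv_def c_cmp_def)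
  next
    case False
    define f where "f = sF s ! m"
    define q where "q = (if f = 0 then m else f)"
    define l where "l = sfl s"
    define s1 where "s1 = tick (c_cmp m 1 + rdc (sF s) m + c_cmp f 0) s"
    define s2 where "s2 = (if sfl s \<noteq> [] \<and> last (sfl s) = q then tick (c_cmp (last (sfl s)) q) s1
                 else push_fl q (tick (if sfl s = [] then 1 else c_cmp (last (sfl s)) q) s1))"
    define s3 where "s3 = tick (c_divmod m q) s2"
    have m2: "2 \<le> m" using False by simp
    have st: "prime q" "q dvd m" "fact_inv x N (m div q) (if l \<noteq> [] \<and> last l = q then l else l @ [q])"
      using fact_inv_step[of x "sF s" m N l q] less.prems m2 unfolding q_def f_def l_def by auto
    have q2: "2 \<le> q" using st(1) by (rule prime_ge_2_nat)
    have qm: "q \<le> m" using st(2) m2 by (intro dvd_imp_le) auto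
    have eq: "fact_loop m s = fact_loop (m div q) s3"
      using False q2 unfolding s3_def s2_def s1_def q_def f_def
      by (subst fact_loop.simps) (simp add: Let_def not_less)
    have bd: "bitlen q + 2 * bitlen (m div q) \<le> 2 * bitlen m" using q2 qm by (rule bitlen_div)
    have bq: "2 \<le> bitlen q" using q2 by (rule bitlen_two_le)
    have qB: "bitlen q \<le> B" using bitlen_mono[OF qm] mB by simp
    have sfl3: "sfl s3 = (if l \<noteq> [] \<and> last l = q then l else l @ [q])"
      unfolding s3_def s2_def s1_def l_def by simp
    have sF3: "sF s3 = sF s" unfolding s3_def s2_def s1_def by simp
    have sum3: "sum_list (map bitlen (sfl s3)) + 2 * bitlen (m div q) \<le> 2 * B"
      using less.prems(7) bd unfolding sfl3 l_def by auto
    have len: "length l \<le> 2 * B" "length (l @ [q]) \<le> 2 * B"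
      using length_le_sum_bitlen[of "l @ [q]"] less.prems(7) bd unfolding l_def by auto
    have inv3: "inv_st x s3"
    proof -
      have "B \<le> x + 1" using less.prems(8) bitlen_le[of x] by linarith
      then show ?thesis using less.prems(3,6) len qm unfolding s3_def s2_def s1_def l_def
        by (auto simp: inv_st_def)
    qed
    have last: "bitlen (last l) \<le> 2 * B" if "l \<noteq> []"
    proof -
      have "bitlen (last l) \<le> sum_list (map bitlen l)" using that by (intro member_le_sum_list) auto
      then show ?thesis using less.prems(7) unfolding l_def by linarith
    qed
    have lenb: "bitlen (length l) \<le> 2 * B"
      using len(1) B1 bitlen_mono[of "length l" "2 * B"] bitlen_le_self[of "2 * B"] by simp
    have fB: "bitlen f \<le> B"
      using sieved_le[of x "sF s" m] less.prems mB bitlen_mono[of f m] unfolding f_def by simp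
    \<comment> \<open>The \<open>9 * B\<close> consists of \<open>4 * B\<close> for testing
      \<open>m\<close> and looking up and testing \<open>f\<close>, \<open>2 * B\<close> for the
      comparison with the last factor, and \<open>3 * B\<close> for the push. The division is kept
      apart.\<close>
    have cost3: "cost s3 \<le> cost s + (9 * B + bitlen m * bitlen q)"
      using mB qB fB lenb last B1 unfolding s3_def s2_def s1_def l_def f_def[symmetric] rdc_def
      by (auto simp: c_cmp_def c_divmod_def rdc_def f_def)
    have mq: "1 \<le> m div q" using q2 qm by (simp add: div_greater_zero_iff Suc_le_eq)
    have "m div q dvd m" using st(2) by (metis dvd_def dvd_mult_div_cancel dvd_triv_right)
    then have IH: "sF (fact_loop (m div q) s3) = sF s3 \<and> inv_st x (fact_loop (m div q) s3) \<and>
     distinct (sfl (fact_loop (m div q) s3)) \<and> (\<forall>q\<in>set (sfl (fact_loop (m div q) s3)). prime q \<and> q dvd N) \<and>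
     sum_list (map bitlen (sfl (fact_loop (m div q) s3))) \<le> 2 * B \<and>
     cost (fact_loop (m div q) s3) \<le> cost s3 + 11 * B * bitlen (m div q)"
      using less.prems m2 q2 mq st(3) sum3 inv3 sF3
      by (intro less.IH) (auto simp: sfl3 intro: dvd_trans order.trans[OF div_le_dividend])
    have "9 * B + bitlen m * bitlen q + 11 * B * bitlen (m div q) \<le> 11 * B * bitlen m"
    proof -
      \<comment> \<open>The drop in bit length. The division costs at most \<open>2 * B * d\<close>,
        and \<open>d \<ge> 1\<close> makes the other \<open>9 * B\<close> at most
        \<open>9 * B * d\<close>.\<close>
      define d where "d = bitlen m - bitlen (m div q)"
      have d: "bitlen m = bitlen (m div q) + d" "1 \<le> d" "bitlen q \<le> 2 * d"
        using bd bq unfolding d_def by auto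
      have "bitlen m * bitlen q \<le> B * (2 * d)" using mB d(3) by (rule mult_le_mono)
      moreover have "B * 1 \<le> B * d" using d(2) by (intro mult_le_mono2)
      ultimately have "9 * B + bitlen m * bitlen q \<le> 11 * (B * d)" by linarith
      then have "9 * B + bitlen m * bitlen q \<le> 11 * B * d" by (simp only: mult.assoc)
      then show ?thesis unfolding d(1) by (simp add: distrib_left)
    qed
    then show ?thesis using IH cost3 sF3 unfolding eq by auto
  qed
qed

subsection \<open>Cost of the five steps\<close>

lemma init_spec:
  assumes "2 \<le> x"
  shows "sF (init x) = replicate (x + 1) 0 \<and> inv_st x (init x) \<and>
    cost (init x) \<le> 8 * (bitlen x * x)"
proof -
  let ?s = "note_cells \<lparr>sF = replicate (x+1) 0, sV = replicate (x+1) 0, sfl = [], cnt = 0,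
                  cost = 0, pcells = 0, pval = 0\<rparr>"
  have "(sF (init x) = replicate (x + 1) 0 \<and> inv_st x (init x)) \<and>
        cost (init x) \<le> cost ?s + (\<Sum>k=0..<x+1. 4 * bitlen x)"
    unfolding init_def
  proof (rule fold_upt_invariant[where I = "\<lambda>_ s. sF s = replicate (x+1) 0 \<and> inv_st x s"])
    show "sF ?s = replicate (x+1) 0 \<and> inv_st x ?s"
      by (simp add: note_cells_def inv_st_def nth_append del: replicate_Suc)
  next
    fix k s assume k: "k < x + 1" and inv: "sF s = replicate (x+1) 0 \<and> inv_st x s"
    have "bitlen k \<le> bitlen x" using k by (intro bitlen_mono) simp
    moreover have "(replicate (x+1) (0::nat))[k := 0] = replicate (x+1) 0"
      using k by (intro nth_equalityI) (auto simp: nth_list_update simp del: replicate_Suc)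
    ultimately show "(sF (wrV k 0 (wrF k 0 s)) = replicate (x+1) 0 \<and> inv_st x (wrV k 0 (wrF k 0 s))) \<and>
         cost (wrV k 0 (wrF k 0 s)) \<le> cost s + 4 * bitlen x"
      using inv assms bitlen_pos[of x] by (auto intro!: inv_st_wrV inv_st_wrF simp del: replicate_Suc)
  qed simp
  moreover have "cost ?s = 0" by (simp add: note_cells_def)
  moreover have "(\<Sum>k=0..<x+1. 4 * bitlen x) \<le> 8 * (bitlen x * x)"
    using assms by (simp add: algebra_simps)
  ultimately show ?thesis by linarith
qed

text \<open>Needed for the failing loop test, which involves the first multiple of \<open>p\<close>
  beyond \<open>x\<close>; that multiple is at most \<open>2 * x\<close>.\<close>

lemma div_Suc_mult_le:
  assumes "0 < p" "p \<le> x" "2 \<le> x"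
  shows "bitlen ((x div p + 1) * p) \<le> 2 * bitlen x"
proof -
  have "(x div p + 1) * p = x div p * p + p" by simp
  also have "\<dots> \<le> x + x" using assms by (intro add_mono) auto
  finally have "bitlen ((x div p + 1) * p) \<le> bitlen (x + x)" by (rule bitlen_mono)
  also have "\<dots> \<le> bitlen x + 1" using bitlen_add[of x x] by simp
  finally show ?thesis using bitlen_pos[of x] by simp
qed

lemma sieve_mark_spec:
  assumes x: "2 \<le> x" and p: "2 \<le> p" "p \<le> x" and inv: "inv_st x s"
  shows "inv_st x (sieve_mark x p s) \<and>
    (\<forall>n. 1 \<le> n \<longrightarrow> n \<le> x \<longrightarrow> sF (sieve_mark x p s) ! n = (if p dvd n then p else sF s ! n)) \<and>
    cost (sieve_mark x p s) \<le> cost s + 4 * bitlen x * (x div p) + 2 * bitlen x"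
proof -
  define t where "t = fold (\<lambda>k s. tick (c_add (k*p) p) (wrF (k*p) p (tick (c_cmp (k*p) x) s)))
        [1..<x div p + 1] s"
  \<comment> \<open>Before iteration \<open>k\<close>, exactly the positive multiples of
    \<open>p\<close> below \<open>k * p\<close> have been overwritten.\<close>
  define I where "I k u \<longleftrightarrow> inv_st x u \<and>
    (\<forall>n. 1 \<le> n \<longrightarrow> n \<le> x \<longrightarrow> sF u ! n = (if p dvd n \<and> n < k * p then p else sF s ! n))" for k u
  have "I (x div p + 1) t \<and> cost t \<le> cost s + (\<Sum>k=1..<x div p + 1. 4 * bitlen x)"
    unfolding t_def
  proof (rule fold_upt_invariant)
    show "I 1 s" using inv by (auto simp: I_def dest: dvd_imp_le)
  next
    fix k u assume k: "1 \<le> k" "k < x div p + 1" and I: "I k u"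
    have kp: "k * p \<le> x" using k p by (simp add: less_Suc_eq_le less_eq_div_iff_mult_less_eq)
    have b: "bitlen (k * p) \<le> bitlen x" "bitlen p \<le> bitlen x" using kp p by (auto intro: bitlen_mono)
    let ?u = "tick (c_add (k*p) p) (wrF (k*p) p (tick (c_cmp (k*p) x) u))"
    have "inv_st x ?u" using I p by (simp add: I_def inv_st_wrF)
    moreover have "sF ?u ! n = (if p dvd n \<and> n < Suc k * p then p else sF s ! n)" if n: "1 \<le> n" "n \<le> x" for n
    proof (cases "n = k * p")
      case True
      then show ?thesis using I kp p by (simp add: I_def inv_st_def)
    next
      case False
      have "n < Suc k * p \<longleftrightarrow> n < k * p" if pn: "p dvd n"
      proof -
        obtain j where "n = p * j" using pn by (elim dvdE)
        then have j: "n = j * p" by (simp only: mult.commute)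
        then have "j < Suc k \<longleftrightarrow> j < k" using False by auto
        then show ?thesis unfolding j mult_less_cancel2 by simp
      qed
      then show ?thesis using False I n by (auto simp: I_def simp del: mult_Suc)
    qed
    moreover have "cost ?u \<le> cost u + 4 * bitlen x" using b by (simp add: c_add_def c_cmp_def)
    ultimately show "I (Suc k) ?u \<and> cost ?u \<le> cost u + 4 * bitlen x" by (simp add: I_def)
  qed simp
  then have t: "I (x div p + 1) t" "cost t \<le> cost s + 4 * bitlen x * (x div p)" by (auto simp: algebra_simps)
  have "n < (x div p + 1) * p" if "n \<le> x" for n
  proof -
    have "x < (x div p + 1) * p" using dividend_less_div_times[of p x] p by simp
    then show ?thesis using that by linarith
  qed
  then have "\<forall>n. 1 \<le> n \<longrightarrow> n \<le> x \<longrightarrow> sF t ! n = (if p dvd n then p else sF s ! n)"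
    using t(1) unfolding I_def by auto
  moreover have "c_cmp ((x div p + 1) * p) x \<le> 2 * bitlen x"
    using div_Suc_mult_le[of p x] p x unfolding c_cmp_def by auto
  ultimately show ?thesis using t unfolding sieve_mark_def t_def[symmetric] by (simp add: I_def)
qed

text \<open>The square test costs \<open>bitlen p * bitlen p\<close>, bounded crudely by
  \<open>bitlen x * p\<close>; this suffices because the candidates, being at most the square root
  of \<open>x\<close>, sum to at most \<open>x\<close>.\<close>

lemma sieve_step_spec:
  assumes x: "2 \<le> x" and p: "2 \<le> p" "p * p \<le> x"
    and inv: "inv_st x s" "\<forall>n. 1 \<le> n \<longrightarrow> n \<le> x \<longrightarrow> sF s ! n = lpf p n"
  shows "inv_st x (sieve_step x p s) \<and> 
    (\<forall>n. 1 \<le> n \<longrightarrow> n \<le> x \<longrightarrow> sF (sieve_step x p s) ! n = lpf (Suc p) n) \<and>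
    cost (sieve_step x p s) \<le> cost s + (bitlen x * p + 8 * bitlen x + (if prime p then 4 * bitlen x * (x div p) else 0))"
proof -
  have px: "p \<le> x" using p by (meson le_square order.trans)
  have b: "bitlen p \<le> bitlen x" "bitlen (p * p) \<le> bitlen x" "bitlen p \<le> p"
    using px p by (auto intro: bitlen_mono bitlen_le_self)
  have Fp: "sF s ! p = lpf p p" using inv p px by simp
  have zero: "sF s ! p = 0 \<longleftrightarrow> prime p" unfolding Fp using p(1) by (rule lpf_self_eq_0_iff)
  have "sF s ! p \<le> x" using lpf_cases[of p p] px unfolding Fp by auto
  then have bF: "bitlen (sF s ! p) \<le> bitlen x" by (rule bitlen_mono)
  define s1 where "s1 = tick (c_mul p p + c_cmp (p*p) x + rdc (sF s) p + c_cmp (sF s ! p) 0) s"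
  have s1: "inv_st x s1" "sF s1 = sF s" using inv by (auto simp: s1_def)
  have "bitlen p * bitlen p \<le> bitlen x * p" using b by (intro mult_le_mono)
  then have c1: "cost s1 \<le> cost s + (bitlen x * p + 4 * bitlen x)"
    using b bF bitlen_pos[of x] by (simp add: s1_def c_mul_def c_cmp_def rdc_def)
  have ca: "c_add p 1 \<le> bitlen x" using b bitlen_pos[of x] by (simp add: c_add_def)
  show ?thesis
  proof (cases "prime p")
    case True
    then have eq: "sieve_step x p s = tick (c_add p 1) (sieve_mark x p s1)"
      using zero by (simp add: sieve_step_def s1_def)
    show ?thesis unfolding eq
      using sieve_mark_spec[OF x p(1) px s1(1)] True s1(2) inv c1 ca by (auto simp: lpf_Suc_prime)
  next
    case False
    then have eq: "sieve_step x p s = tick (c_add p 1) s1"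
      using zero by (simp add: sieve_step_def s1_def)
    show ?thesis unfolding eq using False s1 inv c1 ca by (auto simp: lpf_Suc_not_prime)
  qed
qed

text \<open>Number of cells visited when all multiples of all primes up to \<open>x\<close> are
  enumerated; its size is estimated only at the end.\<close>

definition sum_div_primes :: "nat \<Rightarrow> nat" where
  "sum_div_primes x = (\<Sum>p | prime p \<and> p \<le> x. x div p)"

lemma sum_if_prime_le:
  fixes g :: "nat \<Rightarrow> nat"
  assumes "b \<le> x + 1"
  shows "(\<Sum>p=2..<b. if prime p then g p else 0) \<le> (\<Sum>p | prime p \<and> p \<le> x. g p)"
proof -
  have "(\<Sum>p=2..<b. if prime p then g p else 0) = (\<Sum>p | p \<in> {2..<b} \<and> prime p. g p)"
    by (rule sum.inter_filter[symmetric]) simp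
  also have "\<dots> \<le> (\<Sum>p | prime p \<and> p \<le> x. g p)"
    using assms by (intro sum_mono2) auto
  finally show ?thesis .
qed

lemma sieve_spec:
  assumes x: "2 \<le> x" and inv: "inv_st x s" "sF s = replicate (x + 1) 0"
  shows "inv_st x (sieve x s) \<and> sieved x (sF (sieve x s)) \<and>
    cost (sieve x s) \<le> cost s + 17 * (bitlen x * x) + 4 * (bitlen x * sum_div_primes x)"
proof -
  define ps where "ps = takeWhile (\<lambda>p. p*p \<le> x) [2..<x+1]"
  define m where "m = length ps + 2"
  have len: "length ps \<le> x - 1"
    unfolding ps_def by (rule order.trans[OF length_takeWhile_le]) (use x in simp)
  have ps: "ps = [2..<m]"
  proof -
    have "ps = take (length ps) [2..<x+1]" unfolding ps_def by (rule takeWhile_eq_take)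
    also have "\<dots> = [2..<2 + length ps]" using len x by (intro take_upt) simp
    finally show ?thesis by (simp add: m_def add.commute)
  qed
  have m2: "2 \<le> m" "m \<le> x + 1" using len x by (auto simp: m_def)
  have small: "p * p \<le> x" if "2 \<le> p" "p < m" for p
  proof -
    have "p \<in> set ps" using that by (simp add: ps)
    then show ?thesis unfolding ps_def by (auto dest: set_takeWhileD)
  qed
  \<comment> \<open>Either the scan stopped at \<open>m\<close> because its square exceeds
    \<open>x\<close>, or it exhausted the list and \<open>m = x + 1\<close>.\<close>
  have big: "x < m * m"
  proof (cases "m = x + 1")
    case False
    then have l: "length ps < length [2..<x+1]" using m2 x by (auto simp: m_def)
    then have "\<not> ([2..<x+1] ! length ps) * ([2..<x+1] ! length ps) \<le> x"
      unfolding ps_def by (rule nth_length_takeWhile)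
    then show ?thesis using l by (simp add: m_def nth_upt add.commute not_le del: upt_Suc)
  qed simp
  \<comment> \<open>Identifies the primes below \<open>m\<close> with those whose square is at most
    \<open>x\<close>, so that \<open>lpf m\<close> is the value demanded by
    \<open>sieved\<close>.\<close>
  have small_iff: "q < m \<longleftrightarrow> q * q \<le> x" if "prime q" for q
  proof
    assume "q * q \<le> x"
    show "q < m"
    proof (rule ccontr)
      assume "\<not> q < m"
      then have "m * m \<le> q * q" by (intro mult_le_mono) auto
      then show False using \<open>q * q \<le> x\<close> big by simp
    qed
  qed (use small that prime_ge_2_nat in blast)
  define t where "t = fold (sieve_step x) ps s"
  define I where "I p u \<longleftrightarrow> inv_st x u \<and> (\<forall>n. 1 \<le> n \<longrightarrow> n \<le> x \<longrightarrow> sF u ! n = lpf p n)" for p u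
  have t: "I m t \<and> cost t \<le> cost s + (\<Sum>p=2..<m. bitlen x * p + 8 * bitlen x + (if prime p then 4 * bitlen x * (x div p) else 0))"
    unfolding t_def ps
  proof (rule fold_upt_invariant)
    have "lpf 2 n = 0" for n using lpf_cases[of 2 n] prime_ge_2_nat[of "lpf 2 n"] by linarith
    then show "I 2 s" using inv by (simp add: I_def del: replicate_Suc)
  next
    fix p u assume "2 \<le> p" "p < m" "I p u"
    then show "I (Suc p) (sieve_step x p u) \<and> cost (sieve_step x p u) \<le> cost u + (bitlen x * p + 8 * bitlen x + (if prime p then 4 * bitlen x * (x div p) else 0))"
      using sieve_step_spec[OF x, of p u] small unfolding I_def by blast
  qed (use m2 in simp)
  \<comment> \<open>There are \<open>m - 2\<close> candidates, none above \<open>m - 1\<close>, and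
    \<open>m - 1\<close> itself passed the square test.\<close>
  have S1: "(\<Sum>p=2..<m. bitlen x * p) \<le> bitlen x * x"
  proof (cases "m = 2")
    case False
    have "(\<Sum>p=2..<m. bitlen x * p) \<le> (\<Sum>p=2..<m. bitlen x * (m - 1))"
      by (intro sum_mono mult_le_mono2) auto
    also have "\<dots> = bitlen x * ((m - 2) * (m - 1))" by simp
    also have "\<dots> \<le> bitlen x * ((m - 1) * (m - 1))" by (intro mult_le_mono) auto
    also have "\<dots> \<le> bitlen x * x" using small[of "m - 1"] False m2 by (intro mult_le_mono2) auto
    finally show ?thesis .
  qed simp
  have S2: "(\<Sum>p=2..<m. 8 * bitlen x) \<le> 8 * (bitlen x * x)" using m2 by auto
  have "(\<Sum>p=2..<m. if prime p then 4 * bitlen x * (x div p) else 0) \<le> (\<Sum>p | prime p \<and> p \<le> x. 4 * bitlen x * (x div p))"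
    using m2 by (intro sum_if_prime_le)
  also have "\<dots> = 4 * (bitlen x * sum_div_primes x)" by (simp add: sum_div_primes_def sum_distrib_left mult.assoc)
  finally have S3: "(\<Sum>p=2..<m. if prime p then 4 * bitlen x * (x div p) else 0) \<le> 4 * (bitlen x * sum_div_primes x)" .
  have ct: "cost t \<le> cost s + 9 * (bitlen x * x) + 4 * (bitlen x * sum_div_primes x)"
    using t S1 S2 S3 unfolding sum.distrib by linarith
  have bm: "bitlen m \<le> 2 * bitlen x"
    using bitlen_mono[OF m2(2)] bitlen_add[of x 1] bitlen_pos[of x] by simp
  have bx: "bitlen x \<le> x" using x by (intro bitlen_le_self) simp
  have "c_mul m m \<le> (2 * bitlen x) * (2 * bitlen x)" unfolding c_mul_def using bm by (intro mult_le_mono)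
  also have "\<dots> \<le> 4 * (bitlen x * x)" using bx by simp
  finally have e1: "c_mul m m \<le> 4 * (bitlen x * x)" .
  have "bitlen (m * m) \<le> 4 * bitlen x" using bitlen_mult[of m m] bm by linarith
  then have "c_cmp (m * m) x \<le> 4 * bitlen x * 1" unfolding c_cmp_def by simp
  also have "\<dots> \<le> 4 * bitlen x * x" using x by (intro mult_le_mono2) simp
  finally have e2: "c_cmp (m * m) x \<le> 4 * (bitlen x * x)" by simp
  have eq: "sieve x s = tick (c_mul m m + c_cmp (m * m) x) t"
    unfolding sieve_def Let_def ps_def[symmetric] m_def t_def ..
  have "sieved x (sF t)"
    unfolding sieved_def
  proof (intro allI impI)
    fix n assume n: "1 \<le> n" "n \<le> x"
    then have "sF t ! n = lpf m n" using t by (simp add: I_def)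
    then show "sF t ! n = 0 \<and> (\<forall>q. prime q \<longrightarrow> q * q \<le> x \<longrightarrow> \<not> q dvd n) \<or>
     prime (sF t ! n) \<and> sF t ! n * sF t ! n \<le> x \<and> sF t ! n dvd n \<and>
       (\<forall>q. prime q \<longrightarrow> q * q \<le> x \<longrightarrow> q dvd n \<longrightarrow> q \<le> sF t ! n)"
      using lpf_cases[of m n] small_iff by auto
  qed
  then show ?thesis using t ct e1 e2 unfolding eq by (simp add: I_def)
qed

lemma step2_spec:
  assumes x: "2 \<le> x" and inv: "inv_st x s" "sF s = F"
  shows "inv_st x (step2 x s) \<and> sF (step2 x s) = F \<and> cost (step2 x s) \<le> cost s + 12 * (bitlen x * x)"
proof -
  have bx: "2 \<le> bitlen x" using x by (rule bitlen_two_le)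
  have "(inv_st x (step2 x s) \<and> sF (step2 x s) = F) \<and> cost (step2 x s) \<le> cost s + (\<Sum>n=0..<x+1. 6 * bitlen x)"
    unfolding step2_def
  proof (rule fold_upt_invariant[where I = "\<lambda>_ u. inv_st x u \<and> sF u = F"])
    fix n u assume "n < x + 1" "inv_st x u \<and> sF u = F"
    moreover from this have "bitlen n \<le> bitlen x" by (intro bitlen_mono) simp
    ultimately show "(inv_st x (wrV n (if odd n then 2 else 0) (tick (c_cmp n x + c_add n 1 + c_divmod n 2) u)) \<and>
         sF (wrV n (if odd n then 2 else 0) (tick (c_cmp n x + c_add n 1 + c_divmod n 2) u)) = F) \<and>
        cost (wrV n (if odd n then 2 else 0) (tick (c_cmp n x + c_add n 1 + c_divmod n 2) u)) \<le> cost u + 6 * bitlen x"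
      using x bx by (auto intro!: inv_st_wrV simp: c_cmp_def c_add_def c_divmod_def)
  qed (use inv in auto)
  moreover have "(\<Sum>n=0..<x+1. 6 * bitlen x) \<le> 12 * (bitlen x * x)"
    using x by (simp add: algebra_simps)
  ultimately show ?thesis by linarith
qed

lemma ptest_cost_le:
  assumes "sieved x (sF s)" "2 \<le> p" "p \<le> x"
  shows "c_cmp p x + c_add p 1 + ptest_cost s p \<le> 6 * bitlen x"
proof -
  have "bitlen p \<le> bitlen x" using assms by (intro bitlen_mono) simp
  moreover have "bitlen (sF s ! p) \<le> bitlen x"
    using sieved_le[of x "sF s" p] assms by (intro bitlen_mono) simp
  ultimately show ?thesis using bitlen_pos[of x]
    by (simp add: ptest_cost_def c_cmp_def c_add_def rdc_def)
qed

text \<open>The progression has at most \<open>x div (p * r) + 1\<close> terms at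
  \<open>5 * bitlen x\<close> each. The extra term and the failing test make up the
  \<open>8 * bitlen x\<close>.\<close>

lemma mark_V_spec:
  assumes x: "2 \<le> x" and p: "2 \<le> p" "p \<le> x" and r: "2 \<le> r" "r \<le> x" and inv: "inv_st x s" "sF s = F"
  shows "inv_st x (mark_V x p r s) \<and> sF (mark_V x p r s) = F \<and>
    cost (mark_V x p r s) \<le> cost s + (bitlen x * bitlen r + 8 * bitlen x + 5 * bitlen x * (x div (p * r)))"
proof -
  define pr where "pr = p * r"
  define K where "K = (x - p) div pr + 1"
  define t where "t = fold (\<lambda>k s. tick (c_add (p + k*pr) pr) (wrV (p + k*pr) 0 (tick (c_cmp (p + k*pr) x) s)))
             [0..<K] (tick (c_mul p r) s)"
  have bx: "2 \<le> bitlen x" using x by (rule bitlen_two_le)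
  have b: "bitlen p \<le> bitlen x" "bitlen r \<le> bitlen x" using p r by (auto intro: bitlen_mono)
  \<comment> \<open>The modulus \<open>p * r\<close> may exceed \<open>x\<close>, but it is never
    stored and has at most twice as many bits.\<close>
  have bpr: "bitlen pr \<le> 2 * bitlen x" using bitlen_mult[of p r] b unfolding pr_def by linarith
  have pr0: "0 < pr" using p r by (simp add: pr_def)
  have "(inv_st x t \<and> sF t = F) \<and> cost t \<le> cost (tick (c_mul p r) s) + (\<Sum>k=0..<K. 5 * bitlen x)"
    unfolding t_def
  proof (rule fold_upt_invariant[where I = "\<lambda>_ u. inv_st x u \<and> sF u = F"])
    fix k u assume k: "k < K" and I: "inv_st x u \<and> sF u = F"
    have "k \<le> (x - p) div pr" using k by (simp add: K_def)
    then have "k * pr \<le> x - p" using pr0 by (simp add: less_eq_div_iff_mult_less_eq)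
    then have "bitlen (p + k * pr) \<le> bitlen x" using p by (intro bitlen_mono) simp
    then show "(inv_st x (tick (c_add (p + k*pr) pr) (wrV (p + k*pr) 0 (tick (c_cmp (p + k*pr) x) u))) \<and>
        sF (tick (c_add (p + k*pr) pr) (wrV (p + k*pr) 0 (tick (c_cmp (p + k*pr) x) u))) = F) \<and>
        cost (tick (c_add (p + k*pr) pr) (wrV (p + k*pr) 0 (tick (c_cmp (p + k*pr) x) u))) \<le> cost u + 5 * bitlen x"
      using I x bx bpr by (auto intro!: inv_st_wrV simp: c_cmp_def c_add_def)
  qed (use inv in auto)
  moreover have "c_mul p r \<le> bitlen x * bitlen r" unfolding c_mul_def using b by simp
  moreover have "(\<Sum>k=0..<K. 5 * bitlen x) \<le> 5 * bitlen x * (x div (p * r)) + 5 * bitlen x"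
  proof -
    have "K \<le> x div pr + 1" unfolding K_def by (simp add: div_le_mono)
    then have "K * (5 * bitlen x) \<le> (x div pr + 1) * (5 * bitlen x)" by (rule mult_le_mono1)
    then show ?thesis by (simp add: pr_def algebra_simps)
  qed
  moreover have "c_cmp (p + K * pr) x \<le> 3 * bitlen x"
  proof -
    have "(x - p) div pr * pr \<le> x - p" by simp
    moreover have "p + K * pr = p + (x - p) div pr * pr + pr" by (simp add: K_def)
    ultimately have "p + K * pr \<le> x + pr" using p by linarith
    then have "bitlen (p + K * pr) \<le> bitlen (x + pr)" by (rule bitlen_mono)
    also have "\<dots> \<le> 3 * bitlen x" using bitlen_add[of x pr] bpr bx by simp
    finally show ?thesis by (simp add: c_cmp_def)
  qed
  moreover have "mark_V x p r s = tick (c_cmp (p + K * pr) x) t"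
    by (simp add: mark_V_def Let_def t_def K_def pr_def)
  ultimately show ?thesis by simp
qed

text \<open>Bit lengths are at least 1, so all overhead fits into a multiple of
  \<open>bitlen x * bitlen r\<close>. In this form it can be summed over \<open>r\<close>, since the
  recorded factors have at most \<open>2 * bitlen p\<close> bits altogether.\<close>

lemma proc_r_spec:
  assumes x: "2 \<le> x" and p: "2 \<le> p" "p \<le> x" and r: "2 \<le> r" "r \<le> x" and inv: "inv_st x s" "sF s = F"
  shows "inv_st x (proc_r x p r s) \<and> sF (proc_r x p r s) = F \<and>
    cost (proc_r x p r s) \<le> cost s + (12 * bitlen x * bitlen r + 5 * bitlen x * (x div (p * r)))"
proof -
  define s1 where "s1 = tick (bitlen r + c_divmod r 2) s"
  have s1: "inv_st x s1" "sF s1 = F" "cost s1 = cost s + 3 * bitlen r"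
    using inv by (auto simp: s1_def c_divmod_def)
  have "1 * bitlen r \<le> bitlen x * bitlen r" by (rule mult_le_mono1) (rule bitlen_pos)
  moreover have "bitlen x * 1 \<le> bitlen x * bitlen r" by (rule mult_le_mono2) (rule bitlen_pos)
  ultimately have le: "3 * bitlen r + (bitlen x * bitlen r + 8 * bitlen x) \<le> 12 * (bitlen x * bitlen r)"
    by linarith
  show ?thesis
  proof (cases "odd r")
    case True
    then have "proc_r x p r s = mark_V x p r s1" by (simp add: proc_r_def s1_def)
    moreover have "cost (mark_V x p r s1) \<le> cost s + (12 * bitlen x * bitlen r + 5 * bitlen x * (x div (p * r)))"
      using mark_V_spec[OF x p r s1(1,2)] s1(3) le unfolding mult.assoc by linarith
    ultimately show ?thesis using mark_V_spec[OF x p r s1(1,2)] by simp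
  next
    case False
    then have "proc_r x p r s = s1" by (simp add: proc_r_def s1_def)
    moreover have "cost s1 \<le> cost s + (12 * bitlen x * bitlen r + 5 * bitlen x * (x div (p * r)))"
      using s1(3) le unfolding mult.assoc by linarith
    ultimately show ?thesis using s1 by simp
  qed
qed

definition sum_div_pairs :: "nat \<Rightarrow> nat" where
  "sum_div_pairs x = (\<Sum>p | prime p \<and> p \<le> x. \<Sum>r | prime r \<and> r dvd p - 1. x div (p * r))"

text \<open>The coefficient 36 is 11 for the factorization, 24 for the overhead of the prime
  divisors and 1 for computing \<open>p - 1\<close>.\<close>

lemma step3_spec:
  assumes x: "2 \<le> x" and p: "2 \<le> p" "p \<le> x" and inv: "inv_st x s" "sF s = F" and F: "sieved x F"
  shows "inv_st x (step3 x p s) \<and> sF (step3 x p s) = F \<and>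
    cost (step3 x p s) \<le> cost s + (6 * bitlen x + (if prime p then
      36 * bitlen x * bitlen p + 5 * bitlen x * (\<Sum>r | prime r \<and> r dvd p - 1. x div (p * r)) else 0))"
proof -
  define s0 where "s0 = tick (c_cmp p x + c_add p 1 + ptest_cost s p) s"
  have s0: "inv_st x s0" "sF s0 = F" "cost s0 \<le> cost s + 6 * bitlen x"
    using inv ptest_cost_le[of x s p] F p by (auto simp: s0_def)
  have iff: "is_primeF s p \<longleftrightarrow> prime p"
    unfolding is_primeF_def inv using F p by (rule sieved_prime_iff)
  show ?thesis
  proof (cases "prime p")
    case False
    then have "step3 x p s = s0" using iff by (simp add: step3_def s0_def)
    then show ?thesis using s0 False by simp
  next
    case True
    define u where "u = tick (c_add p 1) (s0\<lparr>sfl := []\<rparr>)"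
    define s1 where "s1 = fact_loop (p - 1) u"
    define s2 where "s2 = fold (proc_r x p) (sfl s1) s1"
    have eq: "step3 x p s = s2\<lparr>sfl := []\<rparr>"
      using True iff by (simp add: step3_def s0_def u_def s1_def s2_def Let_def)
    have bp: "bitlen p \<le> bitlen x" "bitlen (p - 1) \<le> bitlen p" using p by (auto intro: bitlen_mono)
    have cu: "cost u \<le> cost s + 7 * bitlen x"
      using s0(3) bp bitlen_pos[of x] by (simp add: u_def c_add_def)
    have s1: "sF s1 = F" "inv_st x s1" "distinct (sfl s1)" "\<And>q. q \<in> set (sfl s1) \<Longrightarrow> prime q \<and> q dvd p - 1"
      "sum_list (map bitlen (sfl s1)) \<le> 2 * bitlen p" "cost s1 \<le> cost u + 11 * bitlen p * bitlen (p - 1)"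
      using fact_loop_spec[of x u "p - 1" "p - 1" "bitlen p"] F s0 p bp
      unfolding s1_def by (auto simp: u_def fact_inv_def)
    have "(inv_st x s2 \<and> sF s2 = F) \<and>
       cost s2 \<le> cost s1 + (\<Sum>r\<in>set (sfl s1). 12 * bitlen x * bitlen r + 5 * bitlen x * (x div (p * r)))"
      unfolding s2_def
    proof (rule fold_distinct_invariant[where I = "\<lambda>u. inv_st x u \<and> sF u = F"])
      fix r v assume r: "r \<in> set (sfl s1)" and v: "inv_st x v \<and> sF v = F"
      have "2 \<le> r" using s1(4)[OF r] by (auto simp: prime_ge_2_nat)
      moreover have "r \<le> p - 1" using s1(4)[OF r] p by (intro dvd_imp_le) auto
      then have "r \<le> x" using p by simp
      ultimately show "(inv_st x (proc_r x p r v) \<and> sF (proc_r x p r v) = F) \<and>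
         cost (proc_r x p r v) \<le> cost v + (12 * bitlen x * bitlen r + 5 * bitlen x * (x div (p * r)))"
        using proc_r_spec[OF x p, of r v F] v by blast
    qed (use s1 in auto)
    then have s2: "inv_st x s2" "sF s2 = F" 
      "cost s2 \<le> cost s1 + (\<Sum>r\<in>set (sfl s1). 12 * bitlen x * bitlen r + 5 * bitlen x * (x div (p * r)))"
      by auto
    have "(\<Sum>r\<in>set (sfl s1). bitlen r) \<le> 2 * bitlen p"
      using s1(3,5) by (simp add: sum_list_distinct_conv_sum_set)
    then have A: "(\<Sum>r\<in>set (sfl s1). 12 * bitlen x * bitlen r) \<le> 12 * bitlen x * (2 * bitlen p)"
      unfolding sum_distrib_left[symmetric] by (rule mult_le_mono2)
    have "finite {r. prime r \<and> r dvd p - 1}"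
      by (rule finite_subset[OF _ finite_divisors_nat[of "p - 1"]]) (use p in auto)
    then have B: "(\<Sum>r\<in>set (sfl s1). 5 * bitlen x * (x div (p * r))) \<le>
        5 * bitlen x * (\<Sum>r | prime r \<and> r dvd p - 1. x div (p * r))"
      unfolding sum_distrib_left[symmetric] using s1(4) by (intro mult_le_mono2 sum_mono2) auto
    have C: "bitlen p * bitlen (p - 1) \<le> bitlen x * bitlen p"
      using bp by (rule mult_le_mono)
    have D: "bitlen x * 1 \<le> bitlen x * bitlen p" by (rule mult_le_mono2) (rule bitlen_pos)
    have "cost s2 \<le> cost s + (6 * bitlen x + (36 * bitlen x * bitlen p + 5 * bitlen x * (\<Sum>r | prime r \<and> r dvd p - 1. x div (p * r))))"
      using s2(3) s1(6) cu A B C D unfolding sum.distrib mult.assoc by linarith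
    then show ?thesis using True s2 unfolding eq by simp
  qed
qed

text \<open>The Chebyshev-type bound on the total bit length of the primes turns the overhead into
  \<open>36 * 28\<close> times \<open>bitlen x * x\<close>; the primality tests add 6.\<close>

lemma fold_step3_spec:
  assumes x: "2 \<le> x" and inv: "inv_st x s" "sF s = F" and F: "sieved x F"
  shows "inv_st x (fold (step3 x) [2..<x+1] s) \<and> sF (fold (step3 x) [2..<x+1] s) = F \<and>
    cost (fold (step3 x) [2..<x+1] s) \<le> cost s + 1014 * (bitlen x * x) + 5 * (bitlen x * sum_div_pairs x)"
proof -
  let ?g = "\<lambda>p. 36 * bitlen x * bitlen p + 5 * bitlen x * (\<Sum>r | prime r \<and> r dvd p - 1. x div (p * r))"
  have *: "(inv_st x (fold (step3 x) [2..<x+1] s) \<and> sF (fold (step3 x) [2..<x+1] s) = F) \<and>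
    cost (fold (step3 x) [2..<x+1] s) \<le> cost s + (\<Sum>p=2..<x+1. 6 * bitlen x + (if prime p then ?g p else 0))"
  proof (rule fold_upt_invariant[where I = "\<lambda>_ u. inv_st x u \<and> sF u = F"])
    fix p u assume "2 \<le> p" "p < x + 1" "inv_st x u \<and> sF u = F"
    then show "(inv_st x (step3 x p u) \<and> sF (step3 x p u) = F) \<and>
       cost (step3 x p u) \<le> cost u + (6 * bitlen x + (if prime p then ?g p else 0))"
      using step3_spec[OF x, of p u F] F by simp
  qed (use x inv in auto)
  have "(\<Sum>p=2..<x+1. if prime p then ?g p else 0) \<le> (\<Sum>p | prime p \<and> p \<le> x. ?g p)"
    by (rule sum_if_prime_le) simp
  also have "\<dots> = 36 * (bitlen x * (\<Sum>p | prime p \<and> p \<le> x. bitlen p)) + 5 * (bitlen x * sum_div_pairs x)"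
    unfolding sum_div_pairs_def sum.distrib sum_distrib_left mult.assoc ..
  also have "bitlen x * (\<Sum>p | prime p \<and> p \<le> x. bitlen p) \<le> bitlen x * (28 * x)"
    using x by (intro mult_le_mono2 sum_prime_bitlen_le) simp
  finally have "(\<Sum>p=2..<x+1. if prime p then ?g p else 0) \<le> 1008 * (bitlen x * x) + 5 * (bitlen x * sum_div_pairs x)"
    by simp
  moreover have "(\<Sum>p=2..<x+1. 6 * bitlen x) \<le> 6 * (bitlen x * x)" by simp
  ultimately show ?thesis using * unfolding sum.distrib by linarith
qed

lemma step4_spec:
  assumes x: "2 \<le> x" and p: "2 \<le> p" "p \<le> x" and inv: "inv_st x s" "sF s = F" and F: "sieved x F"
  shows "inv_st x (step4 x p s) \<and> sF (step4 x p s) = F \<and>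
    cost (step4 x p s) \<le> cost s + (12 * bitlen x + (if prime p then 8 * bitlen x * (x div p) else 0))"
proof -
  define s0 where "s0 = tick (c_cmp p x + c_add p 1 + ptest_cost s p) s"
  have s0: "inv_st x s0" "sF s0 = F" "cost s0 \<le> cost s + 6 * bitlen x"
    using inv ptest_cost_le[of x s p] F p by (auto simp: s0_def)
  have iff: "is_primeF s p \<longleftrightarrow> prime p"
    unfolding is_primeF_def inv using F p by (rule sieved_prime_iff)
  define s1 where "s1 = tick (c_divmod p 4 + c_cmp (p mod 4) 3) s0"
  have bx: "2 \<le> bitlen x" using x by (rule bitlen_two_le)
  have bp: "bitlen p \<le> bitlen x" using p by (auto intro: bitlen_mono)
  have "bitlen (p mod 4) \<le> bitlen 3" by (rule bitlen_mono) (use pos_mod_bound[of 4 p] in simp)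
  then have s1: "inv_st x s1" "sF s1 = F" "cost s1 \<le> cost s + 10 * bitlen x"
    using s0 bx bp by (auto simp: s1_def c_divmod_def c_cmp_def)
  show ?thesis
  proof (cases "prime p \<and> p mod 4 = 3")
    case False
    then have "step4 x p s = s0 \<or> prime p \<and> step4 x p s = s1" using iff
      by (auto simp: step4_def s0_def s1_def)
    then show ?thesis using s0 s1 by auto
  next
    case True
    define body where "body = (\<lambda>k s. let n = k * p;
                                   s' = tick (c_cmp n x + rdc (sV s) n + c_cmp (sV s ! n) 2) s;
                                   s'' = (if sV s ! n = 2 then wrV n 1 s' else s')
                               in tick (c_add n p) s'')"
    define t where "t = fold body [1..<x div p + 1] s1"
    have eq: "step4 x p s = tick (c_cmp ((x div p + 1) * p) x) t"
      using True iff by (simp add: step4_def s0_def s1_def t_def body_def Let_def)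
    have "(inv_st x t \<and> sF t = F) \<and> cost t \<le> cost s1 + (\<Sum>k=1..<x div p + 1. 8 * bitlen x)"
      unfolding t_def
    proof (rule fold_upt_invariant[where I = "\<lambda>_ u. inv_st x u \<and> sF u = F"])
      fix k u assume k: "k < x div p + 1" and I: "inv_st x u \<and> sF u = F"
      have kp: "k * p \<le> x" using k p by (simp add: less_Suc_eq_le less_eq_div_iff_mult_less_eq)
      then have b: "bitlen (k * p) \<le> bitlen x" by (rule bitlen_mono)
      have "sV u ! (k * p) \<le> 2" using I kp by (simp add: inv_st_def)
      then have "bitlen (sV u ! (k * p)) \<le> 2" using bitlen_mono[of _ 2] by simp
      then show "(inv_st x (body k u) \<and> sF (body k u) = F) \<and> cost (body k u) \<le> cost u + 8 * bitlen x"
        using I b bp bx x by (auto simp: body_def Let_def c_cmp_def c_add_def rdc_def intro!: inv_st_wrV)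
    qed (use s1 in auto)
    moreover have "c_cmp ((x div p + 1) * p) x \<le> 2 * bitlen x"
      using div_Suc_mult_le[of p x] p x unfolding c_cmp_def by auto
    ultimately show ?thesis using True s1 unfolding eq by (simp add: algebra_simps)
  qed
qed

lemma fold_step4_spec:
  assumes x: "2 \<le> x" and inv: "inv_st x s" "sF s = F" and F: "sieved x F"
  shows "inv_st x (fold (step4 x) [2..<x+1] s) \<and>
    cost (fold (step4 x) [2..<x+1] s) \<le> cost s + 12 * (bitlen x * x) + 8 * (bitlen x * sum_div_primes x)"
proof -
  let ?g = "\<lambda>p. 8 * bitlen x * (x div p)"
  have *: "(inv_st x (fold (step4 x) [2..<x+1] s) \<and> sF (fold (step4 x) [2..<x+1] s) = F) \<and>
    cost (fold (step4 x) [2..<x+1] s) \<le> cost s + (\<Sum>p=2..<x+1. 12 * bitlen x + (if prime p then ?g p else 0))"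
  proof (rule fold_upt_invariant[where I = "\<lambda>_ u. inv_st x u \<and> sF u = F"])
    fix p u assume "2 \<le> p" "p < x + 1" "inv_st x u \<and> sF u = F"
    then show "(inv_st x (step4 x p u) \<and> sF (step4 x p u) = F) \<and>
       cost (step4 x p u) \<le> cost u + (12 * bitlen x + (if prime p then ?g p else 0))"
      using step4_spec[OF x, of p u F] F by simp
  qed (use x inv in auto)
  have "(\<Sum>p=2..<x+1. if prime p then ?g p else 0) \<le> (\<Sum>p | prime p \<and> p \<le> x. ?g p)"
    by (rule sum_if_prime_le) simp
  also have "\<dots> = 8 * (bitlen x * sum_div_primes x)"
    unfolding sum_div_primes_def sum_distrib_left mult.assoc ..
  finally have "(\<Sum>p=2..<x+1. if prime p then ?g p else 0) \<le> 8 * (bitlen x * sum_div_primes x)" .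
  moreover have "(\<Sum>p=2..<x+1. 12 * bitlen x) \<le> 12 * (bitlen x * x)" by simp
  ultimately show ?thesis using * unfolding sum.distrib by linarith
qed

lemma step5_spec:
  assumes x: "2 \<le> x" and inv: "inv_st x s"
  shows "pval (step5 x s) \<le> x \<and> pcells (step5 x s) \<le> 4 * (x + 1) \<and>
    cost (step5 x s) \<le> cost s + 16 * (bitlen x * x)"
proof -
  have bx: "2 \<le> bitlen x" using x by (rule bitlen_two_le)
  \<comment> \<open>The counter now changes, so \<open>inv_st\<close> is replaced:
    \<open>cnt u \<le> n\<close> keeps the bit length of the counter below that of
    \<open>x\<close>.\<close>
  define I where "I n u \<longleftrightarrow> cnt u \<le> n \<and> (\<forall>i\<le>x. sV u ! i \<le> 2) \<and> pval u \<le> x \<and> pcells u \<le> 4 * (x + 1)"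
    for n and u :: st
  have "I (x + 1) (step5 x s) \<and> cost (step5 x s) \<le> cost s + (\<Sum>n=0..<x+1. 8 * bitlen x)"
    unfolding step5_def
  proof (rule fold_upt_invariant)
    show "I 0 s" using inv by (simp add: I_def inv_st_def)
  next
    fix n u assume n: "n < x + 1" and I: "I n u"
    have "bitlen n \<le> bitlen x" "bitlen (cnt u) \<le> bitlen x" using n I by (auto intro!: bitlen_mono simp: I_def)
    moreover have "sV u ! n \<le> 2" using n I by (simp add: I_def)
    then have "bitlen (sV u ! n) \<le> 2" using bitlen_mono[of _ 2] by simp
    ultimately show "I (Suc n) (let s' = tick (c_cmp n x + c_add n 1 + rdc (sV u) n + c_cmp (sV u ! n) 1) u
             in if sV u ! n = 1 then tick (c_add (cnt u) 1) (s'\<lparr>cnt := cnt u + 1\<rparr>) else s') \<and>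
        cost (let s' = tick (c_cmp n x + c_add n 1 + rdc (sV u) n + c_cmp (sV u ! n) 1) u
             in if sV u ! n = 1 then tick (c_add (cnt u) 1) (s'\<lparr>cnt := cnt u + 1\<rparr>) else s') \<le> cost u + 8 * bitlen x"
      using I bx by (auto simp: I_def Let_def c_cmp_def c_add_def rdc_def)
  qed simp
  moreover have "(\<Sum>n=0..<x+1. 8 * bitlen x) \<le> 16 * (bitlen x * x)"
    using x by (simp add: algebra_simps)
  ultimately show ?thesis unfolding I_def by linarith
qed

section \<open>Total cost and asymptotics\<close>

lemma run_spec:
  assumes x: "2 \<le> x"
  shows "pval (run x) \<le> x \<and> pcells (run x) \<le> 4 * (x + 1) \<and>
    cost (run x) \<le> 1079 * (bitlen x * x) + 12 * (bitlen x * sum_div_primes x) + 5 * (bitlen x * sum_div_pairs x)"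
proof -
  define s0 where "s0 = init x"
  define s1 where "s1 = sieve x s0"
  define s2 where "s2 = step2 x s1"
  define s3 where "s3 = fold (step3 x) [2..<x+1] s2"
  define s4 where "s4 = fold (step4 x) [2..<x+1] s3"
  note 0 = init_spec[OF x, folded s0_def]
  have 1: "inv_st x s1 \<and> sieved x (sF s1) \<and>
    cost s1 \<le> cost s0 + 17 * (bitlen x * x) + 4 * (bitlen x * sum_div_primes x)"
    unfolding s1_def using 0 by (intro sieve_spec[OF x]) auto
  have 2: "inv_st x s2 \<and> sF s2 = sF s1 \<and> cost s2 \<le> cost s1 + 12 * (bitlen x * x)"
    unfolding s2_def using 1 by (intro step2_spec[OF x]) auto
  have 3: "inv_st x s3 \<and> sF s3 = sF s1 \<and>
    cost s3 \<le> cost s2 + 1014 * (bitlen x * x) + 5 * (bitlen x * sum_div_pairs x)"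
    unfolding s3_def using 1 2 by (intro fold_step3_spec[OF x]) auto
  have 4: "inv_st x s4 \<and> cost s4 \<le> cost s3 + 12 * (bitlen x * x) + 8 * (bitlen x * sum_div_primes x)"
    unfolding s4_def using 1 3 by (intro fold_step4_spec[OF x, where F = "sF s1"]) auto
  have "run x = step5 x s4"
    by (simp add: run_def s0_def s1_def s2_def s3_def s4_def del: upt_Suc)
  moreover have "cost (step5 x s4) \<le> 1079 * (bitlen x * x) + 12 * (bitlen x * sum_div_primes x) +
      5 * (bitlen x * sum_div_pairs x)"
    using step5_spec[OF x, of s4] 0 1 2 3 4 by linarith
  ultimately show ?thesis using step5_spec[OF x, of s4] 4 by simp
qed

lemma sum_div_primes_le: "real (sum_div_primes x) \<le> 7 * (real x * harm (bitlen x))"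
proof -
  have "real (sum_div_primes x) \<le> (\<Sum>p | prime p \<and> p \<le> x. real x * (1 / real p))"
    unfolding sum_div_primes_def of_nat_sum
    by (intro sum_mono) (simp add: of_nat_div_le_of_nat)
  also have "\<dots> \<le> real x * (7 * harm (bitlen x))"
    unfolding sum_distrib_left[symmetric] by (intro mult_left_mono sum_prime_inverse_le) simp
  finally show ?thesis by simp
qed

lemma sum_div_pairs_le: "real (sum_div_pairs x) \<le> 6 * bitlen_const * (real x * harm (bitlen x))"
proof -
  have "real (sum_div_pairs x) \<le>
      (\<Sum>p | prime p \<and> p \<le> x. \<Sum>r | prime r \<and> r dvd p - 1. real x * (1 / (real p * real r)))"
    unfolding sum_div_pairs_def of_nat_sum
    by (intro sum_mono) (simp add: of_nat_div_le_of_nat flip: of_nat_mult)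
  also have "\<dots> \<le> real x * (6 * bitlen_const * harm (bitlen x))"
    unfolding sum_distrib_left[symmetric] by (intro mult_left_mono sum_prime_pairs_le) simp
  finally show ?thesis by (simp add: mult_ac)
qed

text \<open>The sequence \<open>harm n - ln n\<close> decreases from its value 1 at
  \<open>n = 1\<close>.\<close>

lemma harm_le_ln: "1 \<le> n \<Longrightarrow> harm n \<le> 1 + ln (real n)"
  using euler_mascheroni_sequence_decreasing[of 1 n] by (simp add: harm_def)

lemma cost_run_le:
  assumes x: "2 \<le> x"
  shows "real (cost (run x)) \<le> (1163 + 30 * bitlen_const) *
    (real x * (1 + ln (real x) / ln 2) * (1 + ln (1 + ln (real x) / ln 2)))"
proof -
  define L where "L = real (bitlen x)"
  define H where "H = (harm (bitlen x) :: real)"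
  have C0: "0 \<le> bitlen_const" unfolding bitlen_const_def
    by (intro suminf_nonneg summable_bitlen_div_square) auto
  have L1: "1 \<le> L" using bitlen_pos[of x] by (simp add: L_def)
  have H1: "1 \<le> H"
  proof -
    have "harm 1 \<le> H" unfolding H_def using bitlen_pos[of x] by (intro harm_mono)
    then show ?thesis by (simp add: harm_def)
  qed
  have "real (cost (run x)) \<le> real (1079 * (bitlen x * x) + 12 * (bitlen x * sum_div_primes x) + 5 * (bitlen x * sum_div_pairs x))"
    using run_spec[OF x] by (intro of_nat_mono) simp
  also have "\<dots> = 1079 * (L * real x) + 12 * (L * real (sum_div_primes x)) + 5 * (L * real (sum_div_pairs x))"
    by (simp add: L_def)
  \<comment> \<open>\<open>1 \<le> H\<close> lifts the linear term to the common shape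
    \<open>real x * L * H\<close>; then \<open>1079 + 12 * 7 = 1163\<close> and
    \<open>5 * 6 = 30\<close>.\<close>
  also have "\<dots> \<le> 1079 * (L * (real x * H)) + 12 * (L * (7 * (real x * H))) + 5 * (L * (6 * bitlen_const * (real x * H)))"
    using L1 H1 sum_div_primes_le[of x] sum_div_pairs_le[of x] unfolding H_def[symmetric]
    by (intro add_mono mult_left_mono) (auto simp: mult_le_cancel_left1)
  also have "\<dots> = (1163 + 30 * bitlen_const) * (real x * L * H)" by (simp add: algebra_simps)
  also have "\<dots> \<le> (1163 + 30 * bitlen_const) *
    (real x * (1 + ln (real x) / ln 2) * (1 + ln (1 + ln (real x) / ln 2)))"
  proof -
    have LL: "L \<le> 1 + ln (real x) / ln 2" unfolding L_def using x by (intro bitlen_le_ln) simp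
    have "H \<le> 1 + ln L" unfolding H_def L_def using bitlen_pos by (rule harm_le_ln)
    also have "\<dots> \<le> 1 + ln (1 + ln (real x) / ln 2)" using LL L1 by simp
    finally have "H \<le> 1 + ln (1 + ln (real x) / ln 2)" .
    then show ?thesis using C0 L1 H1 LL x by (intro mult_left_mono mult_mono) auto
  qed
  finally show ?thesis .
qed

theorem theorem6p2:
  shows "(\<lambda>x. real (pcells (run x))) \<in> O(\<lambda>x. real x)
       \<and> (\<forall>x\<ge>2. pval (run x) \<le> x)
       \<and> (\<lambda>x. real (cost (run x))) \<in> O(\<lambda>x. real x * ln (real x) * ln (ln (real x)))"
proof (intro conjI allI impI)
  show "(\<lambda>x. real (pcells (run x))) \<in> O(\<lambda>x. real x)"
  proof (rule bigoI[where c = 8], rule eventually_mono[OF eventually_ge_at_top[of 2]])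
    fix x :: nat assume "2 \<le> x"
    then have "pcells (run x) \<le> 4 * (x + 1)" using run_spec by blast
    then show "norm (real (pcells (run x))) \<le> 8 * norm (real x)" using \<open>2 \<le> x\<close> by simp
  qed
  show "pval (run x) \<le> x" if "2 \<le> x" for x using run_spec[OF that] by blast
  \<comment> \<open>The shifted majorant is nonnegative from \<open>x = 2\<close> on, where
    \<open>ln (ln 2)\<close> is still negative; the shifts disappear asymptotically.\<close>
  have "(\<lambda>x. real (cost (run x))) \<in> O(\<lambda>x. real x * (1 + ln (real x) / ln 2) * (1 + ln (1 + ln (real x) / ln 2)))"
  proof (rule bigoI[where c = "1163 + 30 * bitlen_const"], rule eventually_mono[OF eventually_ge_at_top[of 2]])
    fix x :: nat assume x: "2 \<le> x"
    have "0 \<le> ln (real x) / ln 2" using x by simp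
    then have "0 \<le> real x * (1 + ln (real x) / ln 2) * (1 + ln (1 + ln (real x) / ln 2))"
      by (intro mult_nonneg_nonneg add_nonneg_nonneg ln_ge_zero) auto
    then show "norm (real (cost (run x))) \<le> (1163 + 30 * bitlen_const) *
        norm (real x * (1 + ln (real x) / ln 2) * (1 + ln (1 + ln (real x) / ln 2)))"
      using cost_run_le[OF x] by (simp only: real_norm_def abs_of_nonneg of_nat_0_le_iff)
  qed
  also have "(\<lambda>x::nat. real x * (1 + ln (real x) / ln 2) * (1 + ln (1 + ln (real x) / ln 2)))
      \<in> O(\<lambda>x. real x * ln (real x) * ln (ln (real x)))"
    by real_asymp
  finally show "(\<lambda>x. real (cost (run x))) \<in> O(\<lambda>x. real x * ln (real x) * ln (ln (real x)))" .
qed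

end
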